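(* Let $m>0$ be an arbitrary real number, let $\alpha,\beta>0$, $K>0$ and $\Delta\in[0,1]$ be fixed, and let $P_{\mathrm{BER}}=P_{\mathrm{BER}}(\sigma^2)$ be the average bit error rate $\int_0^\infty \frac{\Gamma(\beta,\alpha x)}{2\Gamma(\beta)}f_\gamma(x)\,dx$ of the fluctuating two-ray (FTR) fading channel with parameters $m,K,\Delta,\sigma^2$ (defined in the context). Then in the high-SNR regime $2\sigma^2\to\infty$ the average BER is asymptotically equal to $$P_{\mathrm{BER}}^\infty=\frac{m^m}{2\Gamma(\beta)}\,\frac{\Gamma(\beta+1)}{2\alpha\sigma^2}\left((m+K)^2-(K\Delta)^2\right)^{-\frac{m}{2}}P_{m-1}\left(\frac{m+K}{\sqrt{(m+K)^2-(K\Delta)^2}}\right),$$ that is, $P_{\mathrm{BER}}(\sigma^2)/P_{\mathrm{BER}}^\infty(\sigma^2)\to1$ as $\sigma^2\to\infty$, where $P_{m-1}$ is the Legendre function of the first kind of degree $m-1$ on $[1,\infty)$.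
   Context: FTR fading model. Let $m>0$, $\sigma>0$, and let $V_1,V_2\ge 0$ be constants, not both zero. The complex channel response is $$V_r=\sqrt{\zeta}\,V_1e^{i\phi_1}+\sqrt{\zeta}\,V_2e^{i\phi_2}+X+iY,$$ where $\zeta,\phi_1,\phi_2,X,Y$ are mutually independent; $\zeta$ is Gamma distributed with unit mean and density $f_\zeta(u)=\frac{m^mu^{m-1}}{\Gamma(m)}e^{-mu}$, $u>0$; $\phi_1,\phi_2$ are uniform on $[0,2\pi)$; and $X,Y\sim\mathcal N(0,\sigma^2)$. Define $$K=\frac{V_1^2+V_2^2}{2\sigma^2}>0,\qquad \Delta=\frac{2V_1V_2}{V_1^2+V_2^2}\in[0,1].$$ The transmit SNR $E_b/N_0$ is normalized to $1$, so the instantaneous SNR is $\gamma=|V_r|^2$, with mean $\bar\gamma=2\sigma^2(1+K)$; $f_\gamma$ denotes its probability density function. The distribution of $\gamma$ depends only on $(m,K,\Delta,\sigma^2)$; the limit $\sigma^2\to\infty$ is taken with $m,K,\Delta$ held fixed (so $V_1,V_2$ scale proportionally to $\sigma$), equivalently $\bar\gamma\to\infty$. The constants $\alpha,\beta$ are modulation-specific parameters, and $\Gamma(a,x)=\int_x^\infty t^{a-1}e^{-t}\,dt$ is the upper incomplete gamma function. Legendre function: for real $\nu$ and $z\ge1$, $P_\nu(z)={}_2F_1\left(-\nu,\nu+1;1;\frac{1-z}{2}\right)$ (analytically continued in its argument to $(-\infty,0]$). *)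

theory Defs
  imports "HOL-Probability.Probability" "HOL-Complex_Analysis.Complex_Analysis"
begin

section \<open>The fluctuating two-ray (FTR) channel\<close>

definition unit_mean_gamma_density :: "real \<Rightarrow> real \<Rightarrow> real" where
  "unit_mean_gamma_density m u =
     (if u > 0 then m powr m * u powr (m - 1) / Gamma m * exp (- (m * u)) else 0)"

definition ftr_response ::
    "real \<Rightarrow> real \<Rightarrow> ('a \<Rightarrow> real) \<Rightarrow> ('a \<Rightarrow> real) \<Rightarrow> ('a \<Rightarrow> real) \<Rightarrow> ('a \<Rightarrow> real) \<Rightarrow> ('a \<Rightarrow> real)
      \<Rightarrow> 'a \<Rightarrow> complex" where
  "ftr_response V1 V2 \<zeta> \<phi>1 \<phi>2 X Y \<omega> =
     of_real (sqrt (\<zeta> \<omega>)) * of_real V1 * exp (\<i> * of_real (\<phi>1 \<omega>)) +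
     of_real (sqrt (\<zeta> \<omega>)) * of_real V2 * exp (\<i> * of_real (\<phi>2 \<omega>)) +
     of_real (X \<omega>) + \<i> * of_real (Y \<omega>)"

text \<open>Instantaneous SNR, with the transmit SNR normalized to 1.\<close>
definition ftr_snr ::
    "real \<Rightarrow> real \<Rightarrow> ('a \<Rightarrow> real) \<Rightarrow> ('a \<Rightarrow> real) \<Rightarrow> ('a \<Rightarrow> real) \<Rightarrow> ('a \<Rightarrow> real) \<Rightarrow> ('a \<Rightarrow> real)
      \<Rightarrow> 'a \<Rightarrow> real" where
  "ftr_snr V1 V2 \<zeta> \<phi>1 \<phi>2 X Y \<omega> = (cmod (ftr_response V1 V2 \<zeta> \<phi>1 \<phi>2 X Y \<omega>))\<^sup>2"

text \<open>The parameter \<open>\<sigma>\<close> is the standard deviation of each Gaussian component.\<close>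
locale ftr_channel = prob_space M
  for M :: "'a measure" and m \<sigma> V1 V2 :: real and \<zeta> \<phi>1 \<phi>2 X Y :: "'a \<Rightarrow> real" +
  assumes m_pos: "m > 0"
    and sigma_pos: "\<sigma> > 0"
    and V1_nonneg: "V1 \<ge> 0"
    and V2_nonneg: "V2 \<ge> 0"
    and V_not_both_zero: "\<not> (V1 = 0 \<and> V2 = 0)"
    and zeta_distr: "distributed M lborel \<zeta> (\<lambda>u. ennreal (unit_mean_gamma_density m u))"
    and phi1_distr: "distributed M lborel \<phi>1 (\<lambda>x. ennreal (indicator {0..<2*pi} x / (2*pi)))"
    and phi2_distr: "distributed M lborel \<phi>2 (\<lambda>x. ennreal (indicator {0..<2*pi} x / (2*pi)))"
    and X_distr: "distributed M lborel X (\<lambda>x. ennreal (normal_density 0 \<sigma> x))"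
    and Y_distr: "distributed M lborel Y (\<lambda>x. ennreal (normal_density 0 \<sigma> x))"
    and indep: "indep_vars (\<lambda>_. borel) (\<lambda>i. [\<zeta>, \<phi>1, \<phi>2, X, Y] ! i) {..<5}"

definition ftr_K :: "real \<Rightarrow> real \<Rightarrow> real \<Rightarrow> real" where
  "ftr_K \<sigma> V1 V2 = (V1\<^sup>2 + V2\<^sup>2) / (2 * \<sigma>\<^sup>2)"

definition ftr_Delta :: "real \<Rightarrow> real \<Rightarrow> real" where
  "ftr_Delta V1 V2 = 2 * V1 * V2 / (V1\<^sup>2 + V2\<^sup>2)"


section \<open>Special functions\<close>

definition upper_Gamma :: "real \<Rightarrow> real \<Rightarrow> real" where
  "upper_Gamma a x = (LBINT t:{x<..}. t powr (a - 1) * exp (- t))"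

text \<open>
  Principal branch of Gauss's hypergeometric function: the analytic continuation of the
  hypergeometric series along the straight segment from 0 to \<open>z\<close>, for \<open>z\<close> outside \<open>[1, \<infinity>)\<close>.
  The value depends neither on the function \<open>F\<close> nor on the neighbourhood \<open>U\<close> of the segment,
  see \<open>hyp2F1_eqI\<close> below.
\<close>
definition hyp2F1 :: "complex \<Rightarrow> complex \<Rightarrow> complex \<Rightarrow> complex \<Rightarrow> complex" where
  "hyp2F1 a b c z =
     (THE w. \<exists>F U. open U \<and> closed_segment 0 z \<subseteq> U \<and> F holomorphic_on U \<and>
                   F has_fps_expansion fps_hypergeo [a, b] [c] 1 \<and> F z = w)"

lemma hyp2F1_eqI:
  assumes "open U" "closed_segment 0 z \<subseteq> U" "F holomorphic_on U"
    and "F has_fps_expansion fps_hypergeo [a, b] [c] 1"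
  shows "hyp2F1 a b c z = F z"
  unfolding hyp2F1_def
proof (rule the_equality)
  show "\<exists>F' U. open U \<and> closed_segment 0 z \<subseteq> U \<and> F' holomorphic_on U \<and>
          F' has_fps_expansion fps_hypergeo [a, b] [c] 1 \<and> F' z = F z"
    using assms by blast
next
  fix w
  assume "\<exists>F' U. open U \<and> closed_segment 0 z \<subseteq> U \<and> F' holomorphic_on U \<and>
          F' has_fps_expansion fps_hypergeo [a, b] [c] 1 \<and> F' z = w"
  then obtain G V where G: "open V" "closed_segment 0 z \<subseteq> V" "G holomorphic_on V"
    "G has_fps_expansion fps_hypergeo [a, b] [c] 1" "G z = w"
    by blast
  define S where "S = connected_component_set (U \<inter> V) 0"
  have UV: "closed_segment 0 z \<subseteq> U \<inter> V" "open (U \<inter> V)"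
    using assms G by auto
  have seg: "closed_segment 0 z \<subseteq> S"
    unfolding S_def using UV by (intro connected_component_maximal) auto
  have S: "open S" "connected S" "S \<subseteq> U \<inter> V"
    unfolding S_def
    by (rule open_connected_component[OF UV(2)] connected_connected_component
        connected_component_subset)+
  have ev: "eventually (\<lambda>u. F u = G u) (nhds 0)"
  proof -
    have "eventually (\<lambda>u. eval_fps (fps_hypergeo [a, b] [c] 1) u = F u) (nhds 0)"
      and "eventually (\<lambda>u. eval_fps (fps_hypergeo [a, b] [c] 1) u = G u) (nhds 0)"
      using assms(4) G(4) by (simp_all add: has_fps_expansion_def)
    then show ?thesis by eventually_elim simp
  qed
  then obtain T where T: "open T" "0 \<in> T" "\<And>u. u \<in> T \<Longrightarrow> F u = G u"
    unfolding eventually_nhds by blast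
  have "F z = G z"
  proof (rule analytic_continuation_open[of "S \<inter> T" S F G])
    show "S \<inter> T \<noteq> {}" using seg T(2) by auto
    show "F holomorphic_on S" "G holomorphic_on S"
      using S(3) assms(3) G(3) by (auto intro: holomorphic_on_subset)
  qed (use S seg T in auto)
  with G(5) show "w = F z" by simp
qed

definition legendre_P :: "real \<Rightarrow> real \<Rightarrow> real" where
  "legendre_P \<nu> x =
     Re (hyp2F1 (of_real (- \<nu>)) (of_real (\<nu> + 1)) 1 (of_real ((1 - x) / 2)))"


section \<open>Average bit error rate\<close>

text \<open>The argument \<open>f\<close> is the density of the instantaneous SNR.\<close>
definition avg_BER :: "real \<Rightarrow> real \<Rightarrow> (real \<Rightarrow> real) \<Rightarrow> real" where
  "avg_BER \<alpha> \<beta> f = (LBINT x:{0<..}. upper_Gamma \<beta> (\<alpha> * x) / (2 * Gamma \<beta>) * f x)"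

definition BER_asymptote :: "real \<Rightarrow> real \<Rightarrow> real \<Rightarrow> real \<Rightarrow> real \<Rightarrow> real \<Rightarrow> real" where
  "BER_asymptote m \<alpha> \<beta> K \<Delta> \<sigma> =
     m powr m / (2 * Gamma \<beta>) * (Gamma (\<beta> + 1) / (2 * \<alpha> * \<sigma>\<^sup>2)) *
     ((m + K)\<^sup>2 - (K * \<Delta>)\<^sup>2) powr (- m / 2) *
     legendre_P (m - 1) ((m + K) / sqrt ((m + K)\<^sup>2 - (K * \<Delta>)\<^sup>2))"

end

theory Submission
  imports Defs
begin

text \<open>
  Given the gamma variable and the two phases, the channel response is a complex Gaussian centred at the
  specular component \<open>A\<close>, so it falls into a disc of area \<open>\<pi> c\<close> around \<open>0\<close> with probability close to
  \<open>c / (2 \<sigma>\<^sup>2) exp (- \<bar>A\<bar>\<^sup>2 / (2 \<sigma>\<^sup>2))\<close>; since \<open>exp (- x\<^sup>2 / 2)\<close> is 1-Lipschitz, the error is at most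
  \<open>c powr (3/2) / (2 \<sigma>\<^sup>3)\<close>, uniformly in \<open>A\<close>. By Tonelli the average BER is a gamma integral of the
  distribution function of the SNR, so \<open>\<sigma>\<^sup>2\<close> times it tends to a constant with error \<open>O(1 / \<sigma>)\<close>, the
  constant being proportional to the mean \<open>L\<close> of \<open>exp (- \<bar>A\<bar>\<^sup>2 / (2 \<sigma>\<^sup>2))\<close>, which does not depend on \<open>\<sigma>\<close>.

  The gamma average turns \<open>L\<close> into \<open>m powr m\<close> times the angular mean of
  \<open>(m + K + K \<Delta> cos \<theta>) powr (- m)\<close>. Writing the base as \<open>R \<bar>1 + \<rho> exp (\<i> \<theta>)\<bar>\<^sup>2\<close> and applying
  Parseval to the binomial series gives a multiple of \<open>\<^sub>2F\<^sub>1(m, m; 1; \<rho>\<^sup>2)\<close>, and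
  Pfaff's transformation converts this into the Legendre function.
\<close>

section \<open>Pfaff's transformation\<close>

text \<open>As \<open>G\<close> has no constant term, \<open>G ^ i\<close> vanishes below degree
  \<open>i\<close>. Hence all composition coefficients up to degree \<open>n\<close> may be summed
  over one common range, and the two finite sums interchange.\<close>

lemma fps_mult_compose_nth:
  fixes P H G :: "'a::field_char_0 fps"
  assumes "fps_nth G 0 = 0"
  shows "fps_nth (P * fps_compose H G) n = (\<Sum>i=0..n. fps_nth H i * fps_nth (P * G ^ i) n)"
proof -
  have low: "fps_nth (G ^ i) k = 0" if "k < i" for i k
    using startsby_zero_power_prefix[OF assms] that by blast
  have ext: "fps_nth (fps_compose H G) k = (\<Sum>i=0..n. fps_nth H i * fps_nth (G ^ i) k)" if "k \<le> n" for k
    unfolding fps_compose_nth using that low by (intro sum.mono_neutral_left) auto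
  have "fps_nth (P * fps_compose H G) n =
      (\<Sum>j=0..n. \<Sum>i=0..n. fps_nth P j * (fps_nth H i * fps_nth (G ^ i) (n - j)))"
    unfolding fps_mult_nth by (simp add: ext sum_distrib_left)
  also have "\<dots> = (\<Sum>i=0..n. \<Sum>j=0..n. fps_nth P j * (fps_nth H i * fps_nth (G ^ i) (n - j)))"
    by (rule sum.swap)
  also have "\<dots> = (\<Sum>i=0..n. fps_nth H i * fps_nth (P * G ^ i) n)"
    unfolding fps_mult_nth by (simp add: sum_distrib_left mult_ac)
  finally show ?thesis .
qed

text \<open>Trinomial revision moves the dependence on \<open>i\<close> into
  \<open>(b gchoose i) * (of_nat n gchoose (n - i))\<close>; what remains is Vandermonde's
  convolution.\<close>

lemma gbinomial_square_sum:
  fixes b :: "'a::field_char_0"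
  shows "(\<Sum>i=0..n. (b gchoose i)\<^sup>2 * ((b - of_nat i) gchoose (n - i))) =
    (b gchoose n) * ((b + of_nat n) gchoose n)"
proof -
  have "(b gchoose i)\<^sup>2 * ((b - of_nat i) gchoose (n - i)) =
      (b gchoose n) * ((b gchoose i) * (of_nat n gchoose (n - i)))" if "i \<le> n" for i
    using gbinomial_trinomial_revision[OF that, of b] that
    by (simp add: power2_eq_square binomial_gbinomial[symmetric] binomial_symmetric[of i n] mult_ac)
  hence "(\<Sum>i=0..n. (b gchoose i)\<^sup>2 * ((b - of_nat i) gchoose (n - i))) =
      (\<Sum>i=0..n. (b gchoose n) * ((b gchoose i) * (of_nat n gchoose (n - i))))"
    by (intro sum.cong) auto
  also have "\<dots> = (b gchoose n) * ((b + of_nat n) gchoose n)"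
    by (simp add: sum_distrib_left[symmetric] gbinomial_Vandermonde)
  finally show ?thesis .
qed

text \<open>For \<open>b = -a\<close> this is the series of 2F1(a, a; 1), since -a choose n is
  (-1)^n (a)_n / n! and the sign disappears in the square. Squared binomials are the form in which
  Parseval's identity delivers it.\<close>

definition gbinomial_square_fps :: "complex \<Rightarrow> complex fps" where
  "gbinomial_square_fps b = Abs_fps (\<lambda>n. (b gchoose n)\<^sup>2)"

text \<open>
  Everything is composed with \<open>- X\<close> so that \<open>u / (u - 1)\<close> becomes \<open>X (1 + X)\<^sup>-\<^sup>1\<close> and only binomial
  series in \<open>X\<close> occur.
\<close>
lemma fps_hypergeo_pfaff:
  "fps_compose (fps_binomial (-a) * fps_compose (gbinomial_square_fps (-a)) (fps_X * fps_binomial (-1))) (- fps_X) =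
   fps_hypergeo [1 - a, a] [1] 1"
proof (rule fps_ext)
  fix n
  \<comment> \<open>Each factor \<open>fps_X * fps_binomial (-1)\<close> shifts the degree by one
    and lowers the binomial exponent by one.\<close>
  have *: "fps_binomial (-a) * (fps_X * fps_binomial (-1)) ^ i = fps_X ^ i * fps_binomial (-a - of_nat i)" for i
    unfolding power_mult_distrib fps_binomial_power
    by (simp add: fps_binomial_add_mult[symmetric] mult_ac)
  have "fps_nth (fps_binomial (-a) * fps_compose (gbinomial_square_fps (-a)) (fps_X * fps_binomial (-1))) n
     = (\<Sum>i=0..n. (-a gchoose i)\<^sup>2 * ((-a - of_nat i) gchoose (n - i)))"
    by (subst fps_mult_compose_nth) (simp_all add: * gbinomial_square_fps_def fps_X_power_mult_nth)
  also have "\<dots> = (-a gchoose n) * ((of_nat n - a) gchoose n)"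
    unfolding gbinomial_square_sum by simp
  \<comment> \<open>As rising factorials the two binomials are (-1)^n (a)_n / n! and (1 - a)_n / n!.
    The sign is undone by the composition with \<open>- fps_X\<close>.\<close>
  also have "\<dots> = (-1)^n * fps_nth (fps_hypergeo [1 - a, a] [1] 1) n"
    using gbinomial_pochhammer[of "-a" n] gbinomial_pochhammer'[of "of_nat n - a" n]
    by (simp add: pochhammer_fact[symmetric] field_simps)
  finally show "fps_nth (fps_compose (fps_binomial (-a) * fps_compose (gbinomial_square_fps (-a))
      (fps_X * fps_binomial (-1))) (- fps_X)) n = fps_nth (fps_hypergeo [1 - a, a] [1] 1) n"
    unfolding fps_compose_uminus' by simp
qed

section \<open>Convergence of the squared binomial series\<close>

lemma summable_gbinomial_square:
  assumes "0 \<le> r" "r < 1"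
  shows "summable (\<lambda>n. cmod (b gchoose n) * r ^ n)"
    and "summable (\<lambda>n. (cmod (b gchoose n) * r ^ n)\<^sup>2)"
proof -
  have "ereal (norm (complex_of_real r)) < conv_radius (\<lambda>n. b gchoose n)"
    using assms fps_conv_radius_binomial[of b] by (auto simp: fps_conv_radius_def split: if_splits)
  from abs_summable_in_conv_radius[OF this]
  show 1: "summable (\<lambda>n. cmod (b gchoose n) * r ^ n)"
    using assms by (simp add: norm_mult norm_power)
  \<comment> \<open>Once the terms of the absolutely convergent series are below 1, they dominate
    their own squares.\<close>
  have "(\<lambda>n. cmod (b gchoose n) * r ^ n) \<longlonglongrightarrow> 0"
    by (rule summable_LIMSEQ_zero[OF 1])
  hence "eventually (\<lambda>n. cmod (b gchoose n) * r ^ n < 1) sequentially"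
    by (rule order_tendstoD) simp
  hence "eventually (\<lambda>n. norm ((cmod (b gchoose n) * r ^ n)\<^sup>2) \<le> cmod (b gchoose n) * r ^ n) sequentially"
  proof eventually_elim
    case (elim n)
    have "0 \<le> cmod (b gchoose n) * r ^ n" using assms by simp
    thus ?case using elim unfolding power2_eq_square
      by (smt (verit, best) mult_left_le real_norm_def mult_nonneg_nonneg)
  qed
  thus "summable (\<lambda>n. (cmod (b gchoose n) * r ^ n)\<^sup>2)"
    by (rule summable_comparison_test_ev[OF _ 1])
qed

text \<open>A term of this series at \<open>r\<close> is the square of a binomial term at
  \<open>sqrt r\<close>, which is still inside the unit disc.\<close>

lemma conv_radius_gbinomial_square: "fps_conv_radius (gbinomial_square_fps b) \<ge> 1"
  unfolding fps_conv_radius_def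
proof (rule conv_radius_geI_ex)
  fix r :: real assume r: "0 < r" "ereal r < 1"
  have "summable (\<lambda>n. (cmod (b gchoose n) * sqrt r ^ n)\<^sup>2)"
    using r by (intro summable_gbinomial_square) auto
  moreover have "(cmod (b gchoose n) * sqrt r ^ n)\<^sup>2 = norm (fps_nth (gbinomial_square_fps b) n * of_real r ^ n)" for n
    using r by (simp add: gbinomial_square_fps_def norm_mult norm_power power_mult_distrib power_mult[symmetric] mult.commute
        real_sqrt_power[symmetric]) (simp add: power_mult)
  ultimately have "summable (\<lambda>n. norm (fps_nth (gbinomial_square_fps b) n * of_real r ^ n))" by simp
  hence "summable (\<lambda>n. fps_nth (gbinomial_square_fps b) n * of_real r ^ n)" by (rule summable_norm_cancel)
  thus "\<exists>z. norm z = r \<and> summable (\<lambda>n. fps_nth (gbinomial_square_fps b) n * z ^ n)"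
    using r by (intro exI[of _ "of_real r"]) auto
qed

text \<open>The half-plane \<open>Re u < 1/2\<close> is convex, contains 0 and is mapped into the
  unit disc by \<open>u / (u - 1)\<close>, so the right-hand side is holomorphic along the whole
  segment from 0 to \<open>u\<close>. By \<open>hyp2F1_eqI\<close> only the expansions at 0 have to
  be compared.\<close>

lemma hyp2F1_pfaff:
  assumes "Re u < 1/2"
  shows "hyp2F1 (1 - a) a 1 u = (1 - u) powr (-a) * eval_fps (gbinomial_square_fps (-a)) (u / (u - 1))"
proof -
  define U where "U = {u :: complex. Re u < 1/2}"
  define F where "F = (\<lambda>u::complex. (1 - u) powr (-a) * eval_fps (gbinomial_square_fps (-a)) (u / (u - 1)))"
  have "open U" unfolding U_def by (rule open_halfspace_Re_lt)
  have "convex U" unfolding U_def by (rule convex_halfspace_Re_lt)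
  hence "closed_segment 0 u \<subseteq> U" 
    using assms by (intro closed_segment_subset) (auto simp: U_def)
  have nz: "z \<noteq> 1" if "z \<in> U" for z using that by (auto simp: U_def)
  have lt1: "cmod (z / (z - 1)) < 1" if "z \<in> U" for z
  proof -
    \<comment> \<open>\<open>Re z < 1/2\<close> means that \<open>z\<close> is closer to 0 than to
      1.\<close>
    have "(cmod z)\<^sup>2 < (cmod (z - 1))\<^sup>2"
      using that unfolding cmod_power2 U_def by (simp add: power2_eq_square algebra_simps)
    thus ?thesis using nz[OF that] power_less_imp_less_base[of "cmod z" 2 "cmod (z-1)"]
      by (simp add: norm_divide divide_simps)
  qed
  have holo: "F holomorphic_on U"
  proof -
    have "eval_fps (gbinomial_square_fps (-a)) holomorphic_on ball 0 1"
      by (intro holomorphic_on_eval_fps)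
        (auto simp: eball_def one_ereal_def intro!: less_le_trans[OF _ conv_radius_gbinomial_square])
    moreover have "(\<lambda>u. u / (u - 1)) holomorphic_on U"
      using nz by (intro holomorphic_intros) auto
    moreover have "(\<lambda>u. u / (u - 1)) ` U \<subseteq> ball 0 1"
      using lt1 by auto
    ultimately have "(\<lambda>u. eval_fps (gbinomial_square_fps (-a)) (u / (u - 1))) holomorphic_on U"
      using holomorphic_on_compose_gen[unfolded o_def] by blast
    moreover have "(\<lambda>u. (1 - u) powr (-a)) holomorphic_on U"
      by (intro holomorphic_intros) (auto simp: U_def complex_nonpos_Reals_iff)
    ultimately show ?thesis
      unfolding F_def by (rule holomorphic_on_mult[rotated])
  qed
  \<comment> \<open>\<open>F'\<close> is \<open>F\<close> reflected at the origin, which puts it in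
    terms of powers of \<open>1 + u\<close> with their standard binomial expansions; composing with
    negation recovers \<open>F\<close>.\<close>
  define F' where "F' = (\<lambda>u::complex. (1 + u) powr (-a) * (eval_fps (gbinomial_square_fps (-a)) \<circ> (\<lambda>u. u * (1 + u) powr (-1))) u)"
  have "0 < fps_conv_radius (gbinomial_square_fps (- a))"
    using less_le_trans[OF _ conv_radius_gbinomial_square, of 0] by simp
  hence "F' has_fps_expansion (fps_binomial (-a) * fps_compose (gbinomial_square_fps (-a)) (fps_X * fps_binomial (-1)))"
    unfolding F'_def by (intro fps_expansion_intros eval_fps_has_fps_expansion) auto
  hence "(F' \<circ> (\<lambda>z. - z)) has_fps_expansion fps_compose (fps_binomial (-a) * fps_compose (gbinomial_square_fps (-a)) (fps_X * fps_binomial (-1))) (- fps_X)"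
    by (intro fps_expansion_intros) auto
  also have "F' \<circ> (\<lambda>z. - z) = F"
    by (auto simp: F'_def F_def fun_eq_iff powr_minus field_simps)
       (metis add.inverse_inverse minus_diff_eq minus_divide_divide minus_divide_left)
  finally have "F has_fps_expansion fps_hypergeo [1 - a, a] [1] 1" 
    unfolding fps_hypergeo_pfaff .
  from hyp2F1_eqI[OF \<open>open U\<close> \<open>closed_segment 0 u \<subseteq> U\<close> holo this] show ?thesis
    by (simp add: F_def)
qed

section \<open>Laplace's integral for the Legendre function\<close>

text \<open>The summable bound \<open>w\<close> is a Weierstrass majorant. On an interval of finite
  length it also makes the integrals of the norms summable, which is what the exchange of sum and
  integral requires.\<close>

lemma LBINT_sums:
  fixes u :: "nat \<Rightarrow> real \<Rightarrow> complex"
  assumes cont: "\<And>n. continuous_on {a..b} (u n)"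
    and bound: "\<And>n t. t \<in> {a..b} \<Longrightarrow> cmod (u n t) \<le> w n" and w: "summable w"
    and s: "\<And>t. t \<in> {a..b} \<Longrightarrow> (\<lambda>n. u n t) sums s t"
  shows "(\<lambda>n. LBINT t:{a..b}. u n t) sums (LBINT t:{a..b}. s t)"
proof -
  have int: "integrable lborel (\<lambda>t. indicator {a..b} t *\<^sub>R u n t)" for n
    by (rule borel_integrable_compact[OF compact_Icc cont])
  have "(\<lambda>n. LBINT t. indicator {a..b} t *\<^sub>R u n t) sums (LBINT t. (\<Sum>n. indicator {a..b} t *\<^sub>R u n t))"
  proof (rule sums_integral[OF int])
    show "AE t in lborel. summable (\<lambda>n. norm (indicator {a..b} t *\<^sub>R u n t))"
    proof (rule AE_I2)
      fix t
      show "summable (\<lambda>n. norm (indicator {a..b} t *\<^sub>R u n t))"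
        using summable_comparison_test'[OF w, of 0 "\<lambda>n. cmod (u n t)"] bound by (cases "t \<in> {a..b}") auto
    qed
    have "norm (LBINT t. norm (indicator {a..b} t *\<^sub>R u n t)) \<le> w n * measure lborel {a..b}" for n
    proof -
      have "norm (LBINT t. norm (indicator {a..b} t *\<^sub>R u n t)) = (LBINT t. norm (indicator {a..b} t *\<^sub>R u n t))"
        by simp
      also have "\<dots> \<le> (LBINT t. w n * indicator {a..b} t)"
        by (intro integral_mono integrable_norm[OF int] integrable_mult_right integrable_real_indicator)
           (simp_all add: bound emeasure_lborel_Icc_eq split: split_indicator)
      finally show ?thesis by simp
    qed
    thus "summable (\<lambda>n. LBINT t. norm (indicator {a..b} t *\<^sub>R u n t))"
      by (intro summable_comparison_test'[OF summable_mult2[OF w], of 0])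
  qed
  moreover have "(\<Sum>n. indicator {a..b} t *\<^sub>R u n t) = indicator {a..b} t *\<^sub>R s t" for t
    using s[of t] by (auto simp: indicator_def sums_iff)
  ultimately show ?thesis by (simp add: set_lebesgue_integral_def)
qed

lemma LBINT_cis_full_period:
  fixes k :: int
  shows "(LBINT t:{0..2*pi}. cis (of_int k * (t - p))) = (if k = 0 then 2 * pi else 0)"
proof (cases "k = 0")
  case True
  thus ?thesis by (simp add: set_lebesgue_integral_def scaleR_conv_of_real)
next
  case False
  have "(LBINT t. indicator {0..2*pi} t *\<^sub>R cis (of_int k * (t - p))) =
     - \<i> / of_int k * cis (of_int k * (2*pi - p)) - - \<i> / of_int k * cis (of_int k * (0 - p))"
    using False
    by (intro integral_FTC_Icc)
       (auto intro!: derivative_eq_intros continuous_intros simp: has_vector_derivative_def fun_eq_iff complex_eq_iff)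
  \<comment> \<open>Integrality of \<open>k\<close> makes the antiderivative agree at both ends of
    the period.\<close>
  moreover have "cis (of_int k * (2*pi - p)) = cis (of_int k * (0 - p))"
  proof -
    have "cis (of_int k * (2*pi - p)) = cis (2*pi * of_int k) * cis (of_int k * (0 - p))"
      unfolding cis_mult by (simp add: algebra_simps)
    thus ?thesis by (simp add: cis_multiple_2pi)
  qed
  ultimately show ?thesis using False by (simp add: set_lebesgue_integral_def)
qed

text \<open>
  The arbitrary phase shift \<open>p\<close> spares us a translation argument for periodic functions when
  averaging over the difference of two phases.
\<close>
lemma parseval:
  fixes a :: "nat \<Rightarrow> complex" and h :: "real \<Rightarrow> complex"
  assumes a: "summable (\<lambda>n. cmod (a n))" and h: "continuous_on {0..2*pi} h"
    and sums: "\<And>t. t \<in> {0..2*pi} \<Longrightarrow> (\<lambda>n. a n * cis (of_nat n * (t - p))) sums h t"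
  shows "(\<lambda>n. 2 * pi * (cmod (a n))\<^sup>2) sums (LBINT t:{0..2*pi}. (cmod (h t))\<^sup>2)"
proof -
  \<comment> \<open>Only \<open>cnj (h t)\<close> is expanded here; orthogonality of the
    exponentials leaves the single term \<open>k = n\<close>.\<close>
  have coeff: "(LBINT t:{0..2*pi}. a n * cis (of_nat n * (t - p)) * cnj (h t)) = of_real (2 * pi * (cmod (a n))\<^sup>2)" for n
  proof -
    have "(\<lambda>k. LBINT t:{0..2*pi}. a n * cis (of_nat n * (t - p)) * cnj (a k * cis (of_nat k * (t - p)))) sums
        (LBINT t:{0..2*pi}. a n * cis (of_nat n * (t - p)) * cnj (h t))"
    proof (rule LBINT_sums)
      show "summable (\<lambda>k. cmod (a n) * cmod (a k))" using a by (rule summable_mult)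
      fix t assume t: "t \<in> {0..2*pi}"
      show "(\<lambda>k. a n * cis (of_nat n * (t - p)) * cnj (a k * cis (of_nat k * (t - p)))) sums
          (a n * cis (of_nat n * (t - p)) * cnj (h t))"
        by (rule sums_mult) (subst sums_cnj, rule sums[OF t])
    qed (auto intro!: continuous_intros simp: norm_mult)
    moreover have "a n * cis (of_nat n * (t - p)) * cnj (a k * cis (of_nat k * (t - p))) =
        a n * cnj (a k) * cis (of_int (int n - int k) * (t - p))" for k t
      by (simp add: cis_cnj cis_mult) (simp add: algebra_simps)
    hence "(LBINT t:{0..2*pi}. a n * cis (of_nat n * (t - p)) * cnj (a k * cis (of_nat k * (t - p)))) =
        a n * cnj (a k) * (LBINT t:{0..2*pi}. cis (of_int (int n - int k) * (t - p)))" for k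
      by (simp only: set_integral_mult_right)
    hence "(LBINT t:{0..2*pi}. a n * cis (of_nat n * (t - p)) * cnj (a k * cis (of_nat k * (t - p)))) =
        (if k = n then of_real (2 * pi * (cmod (a n))\<^sup>2) else 0)" for k
      unfolding LBINT_cis_full_period by (simp add: complex_norm_square[symmetric] del: of_real_power)
    ultimately show ?thesis
      using sums_unique2[OF sums_single[of n "\<lambda>_. complex_of_real (2 * pi * (cmod (a n))\<^sup>2)"]] by simp
  qed
  \<comment> \<open>Now the other factor is expanded. The sum \<open>B\<close> of the coefficient
    moduli bounds \<open>cmod (h t)\<close>, so the series stays dominated after multiplication by
    \<open>cnj (h t)\<close>.\<close>
  have "(\<lambda>n. LBINT t:{0..2*pi}. a n * cis (of_nat n * (t - p)) * cnj (h t)) sums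
      (LBINT t:{0..2*pi}. h t * cnj (h t))"
  proof (rule LBINT_sums)
    define B where "B = (\<Sum>n. cmod (a n))"
    show "summable (\<lambda>n. cmod (a n) * B)" using a by (rule summable_mult2)
    fix t assume t: "t \<in> {0..2*pi}"
    show "(\<lambda>n. a n * cis (of_nat n * (t - p)) * cnj (h t)) sums (h t * cnj (h t))"
      by (rule sums_mult2) (rule sums[OF t])
    have "cmod (h t) \<le> B"
      using norm_suminf_le[of "\<lambda>n. a n * cis (of_nat n * (t - p))" "\<lambda>n. cmod (a n)"] a sums[OF t]
      by (simp add: norm_mult sums_iff B_def)
    thus "cmod (a n * cis (of_nat n * (t - p)) * cnj (h t)) \<le> cmod (a n) * B" for n
      by (simp add: norm_mult mult_left_mono)
  qed (auto intro!: continuous_intros h)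
  hence "(\<lambda>n. complex_of_real (2 * pi * (cmod (a n))\<^sup>2)) sums (LBINT t:{0..2*pi}. of_real ((cmod (h t))\<^sup>2))"
    unfolding coeff complex_norm_square .
  thus ?thesis
    unfolding set_integral_complex_of_real sums_of_real_iff .
qed

text \<open>Parseval's identity for the binomial series of the power \<open>b\<close> of 1 + r e^(i
  (t - p)). For a real exponent the modulus of a power is the power of the modulus, so the squared
  modulus is the integrand.\<close>

lemma LBINT_norm_binomial:
  fixes r b p :: real
  assumes "0 \<le> r" "r < 1"
  shows "(\<lambda>n. 2 * pi * (b gchoose n)\<^sup>2 * (r\<^sup>2) ^ n) sums
    (LBINT t:{0..2*pi}. (1 + r\<^sup>2 + 2 * r * cos (t - p)) powr b)"
proof -
  define h where "h = (\<lambda>t. (1 + of_real r * cis (t - p)) powr (of_real b))"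
  have gb: "complex_of_real b gchoose n = of_real (b gchoose n)" for n
    by (simp add: gbinomial_prod_rev)
  have lt1: "cmod (of_real r * cis t) < 1" for t using assms by (simp add: norm_mult)
  have "(\<lambda>n. 2 * pi * (cmod ((of_real b gchoose n) * of_real r ^ n))\<^sup>2) sums (LBINT t:{0..2*pi}. (cmod (h t))\<^sup>2)"
  proof (rule parseval[where p = p])
    show "summable (\<lambda>n. cmod ((complex_of_real b gchoose n) * of_real r ^ n))"
      using summable_gbinomial_square(1)[OF assms, of "of_real b"] assms by (simp add: norm_mult norm_power)
    \<comment> \<open>Since \<open>r < 1\<close>, the base stays in the right half-plane, away from
      the branch cut of the complex power.\<close>
    have "Re (1 + of_real r * cis (t - p)) > 0" for t
      using lt1[of "t - p"] abs_Re_le_cmod[of "of_real r * cis (t - p)"] by auto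
    hence pos: "0 \<le> Re (1 + of_real r * cis (t - p))" "1 + of_real r * cis (t - p) \<noteq> 0" for t
      using less_imp_le[of 0 "Re (1 + of_real r * cis (t - p))"] by (simp, metis less_irrefl zero_complex.simps(1))
    show "continuous_on {0..2*pi} h"
      unfolding h_def
      by (rule continuous_on_powr_complex) (use pos in \<open>auto intro!: continuous_intros simp del: plus_complex.sel\<close>)
    fix t
    show "(\<lambda>n. (complex_of_real b gchoose n) * of_real r ^ n * cis (of_nat n * (t - p))) sums h t"
    proof -
      have "(\<lambda>n. fps_nth (fps_binomial (of_real b)) n * (of_real r * cis (t - p)) ^ n) sums
          eval_fps (fps_binomial (of_real b)) (of_real r * cis (t - p))"
        using lt1[of "t - p"] by (intro sums_eval_fps) (simp add: fps_conv_radius_binomial)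
      also have "eval_fps (fps_binomial (of_real b)) (of_real r * cis (t - p)) = h t"
        using lt1[of "t - p"] by (simp add: eval_fps_binomial h_def)
      finally show ?thesis
        by (simp only: power_mult_distrib Complex.DeMoivre fps_binomial_nth mult.assoc)
    qed
  qed
  moreover have "(cmod ((of_real b gchoose n) * of_real r ^ n))\<^sup>2 = (b gchoose n)\<^sup>2 * (r\<^sup>2) ^ n" for n
    using assms by (simp add: gb norm_mult norm_power power_mult_distrib power_mult[symmetric] mult.commute)
  moreover have "(cmod (h t))\<^sup>2 = (1 + r\<^sup>2 + 2 * r * cos (t - p)) powr b" for t
  proof -
    have sq: "(cmod (1 + of_real r * cis (t - p)))\<^sup>2 = 1 + r\<^sup>2 + 2 * r * cos (t - p)"
      unfolding cmod_power2 using sin_cos_squared_add3[of "t - p"]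
      by (simp add: power2_eq_square algebra_simps) (simp add: distrib_left[symmetric])
    have "(cmod (h t))\<^sup>2 = (cmod (1 + of_real r * cis (t - p)) powr b) * (cmod (1 + of_real r * cis (t - p)) powr b)"
      by (simp add: h_def norm_powr_real_powr' power2_eq_square)
    also have "\<dots> = (cmod (1 + of_real r * cis (t - p)) * cmod (1 + of_real r * cis (t - p))) powr b"
      by (simp add: powr_mult)
    finally show ?thesis by (simp only: sq[symmetric] power2_eq_square[of "cmod _"])
  qed
  ultimately show ?thesis by (simp add: mult_ac)
qed

text \<open>Links the real series coming from Parseval's identity with the complex one in Pfaff's
  transformation.\<close>

lemma eval_gbinomial_square_fps_of_real:
  assumes "0 \<le> x" "x < 1"
  shows "eval_fps (gbinomial_square_fps (of_real b)) (of_real x) = of_real (\<Sum>n. (b gchoose n)\<^sup>2 * x ^ n)"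
proof -
  have gb: "complex_of_real b gchoose n = of_real (b gchoose n)" for n
    by (simp add: gbinomial_prod_rev)
  have "(\<lambda>n. fps_nth (gbinomial_square_fps (of_real b)) n * of_real x ^ n) sums
      eval_fps (gbinomial_square_fps (of_real b)) (of_real x)"
    using assms by (intro sums_eval_fps less_le_trans[OF _ conv_radius_gbinomial_square]) (simp add: one_ereal_def)
  hence *: "(\<lambda>n. complex_of_real ((b gchoose n)\<^sup>2 * x ^ n)) sums
      eval_fps (gbinomial_square_fps (of_real b)) (of_real x)"
    by (simp add: gbinomial_square_fps_def gb)
  from sums_Re[OF this] have "(\<lambda>n. (b gchoose n)\<^sup>2 * x ^ n) sums Re (eval_fps (gbinomial_square_fps (of_real b)) (of_real x))"
    by (simp del: of_real_mult of_real_power)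
  from sums_of_real[OF summable_sums[OF sums_summable[OF this]], where 'a = complex] * show ?thesis
    by (rule sums_unique2[rotated])
qed

text \<open>Laplace's second integral for degree \<open>m - 1\<close>, in homogeneous form: dividing
  the base by \<open>sqrt (p\<^sup>2 - q\<^sup>2)\<close> gives the classical z + sqrt(z^2 - 1) cos
  t. Both sides are evaluated as the same squared binomial series, the integral by Parseval and the
  Legendre function by Pfaff.\<close>

lemma laplace_integral_legendre_P:
  fixes p q m \<phi> :: real
  assumes "0 \<le> q" "q < p"
  shows "(LBINT t:{0..2*pi}. (p + q * cos (t - \<phi>)) powr (-m)) =
    2 * pi * ((p\<^sup>2 - q\<^sup>2) powr (-m/2) * legendre_P (m - 1) (p / sqrt (p\<^sup>2 - q\<^sup>2)))"
proof -
  define d where "d = sqrt (p\<^sup>2 - q\<^sup>2)"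
  \<comment> \<open>\<open>R\<close> and \<open>x\<close> solve \<open>R * (1 + x) = p\<close> and
    \<open>R * sqrt x = q / 2\<close>, with the root \<open>x < 1\<close>, so that the base is
    \<open>R\<close> times the squared modulus of 1 + sqrt(x) e^(i t).\<close>
  define R where "R = (p + d) / 2"
  define x where "x = (p - d) / (p + d)"
  define S where "S = (\<Sum>n. (-m gchoose n)\<^sup>2 * x ^ n)"
  have pq: "p\<^sup>2 - q\<^sup>2 > 0" using assms by (simp add: power_strict_mono)
  hence d: "d > 0" "d\<^sup>2 = p\<^sup>2 - q\<^sup>2" unfolding d_def by auto
  have "d \<le> p" using d(2) assms by (intro power2_le_imp_le[of d p]) auto
  have R: "R > 0" using assms d by (simp add: R_def)
  have x: "0 \<le> x" "x < 1" using \<open>d \<le> p\<close> d assms by (auto simp: x_def divide_simps)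
  have Rx: "R * sqrt x = q / 2"
  proof -
    have "R * x = (p - d) / 2" using assms d by (simp add: R_def x_def divide_simps)
    hence "(R * sqrt x)\<^sup>2 = R * ((p - d) / 2)"
      using x by (simp add: power_mult_distrib power2_eq_square[of R] mult.assoc)
    also have "\<dots> = (p\<^sup>2 - d\<^sup>2) / 4"
      by (simp add: R_def power2_eq_square algebra_simps)
    finally have "(R * sqrt x)\<^sup>2 = (q / 2)\<^sup>2"
      using d by (simp add: power_divide)
    thus ?thesis using R x assms by (simp add: power2_eq_iff_nonneg)
  qed
  have Rp: "R * (1 + x) = p" using assms d by (simp add: R_def x_def field_simps)
  have factor: "p + q * cos t = R * (1 + (sqrt x)\<^sup>2 + 2 * sqrt x * cos t)" for t
  proof -
    have "R * (1 + (sqrt x)\<^sup>2 + 2 * sqrt x * cos t) = R * (1 + x) + 2 * (R * sqrt x) * cos t"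
      using x by (simp add: algebra_simps)
    thus ?thesis unfolding Rx Rp by simp
  qed
  have nonneg: "0 \<le> 1 + (sqrt x)\<^sup>2 + 2 * sqrt x * cos t" for t
  proof -
    have "2 * sqrt x * (-1) \<le> 2 * sqrt x * cos t" using x by (intro mult_left_mono) auto
    moreover have "0 \<le> (1 - sqrt x)\<^sup>2" by simp
    ultimately show ?thesis by (simp add: power2_eq_square algebra_simps)
  qed
  have "(LBINT t:{0..2*pi}. (p + q * cos (t - \<phi>)) powr (-m)) =
      (LBINT t:{0..2*pi}. R powr (-m) * (1 + (sqrt x)\<^sup>2 + 2 * sqrt x * cos (t - \<phi>)) powr (-m))"
    unfolding factor using R nonneg by (simp only: powr_mult less_imp_le)
  also have "\<dots> = R powr (-m) * (2 * pi * S)"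
  proof -
    have "(\<lambda>n. 2 * pi * ((-m gchoose n)\<^sup>2 * x ^ n)) sums
      (LBINT t:{0..2*pi}. (1 + (sqrt x)\<^sup>2 + 2 * sqrt x * cos (t - \<phi>)) powr (-m))"
      using LBINT_norm_binomial[of "sqrt x" "-m" \<phi>] x by (simp add: mult_ac)
    moreover from this have "summable (\<lambda>n. (-m gchoose n)\<^sup>2 * x ^ n)"
      by (intro summable_mult_D[OF sums_summable]) auto
    hence "(\<lambda>n. 2 * pi * ((-m gchoose n)\<^sup>2 * x ^ n)) sums (2 * pi * S)"
      unfolding S_def by (intro sums_mult summable_sums)
    ultimately have "(LBINT t:{0..2*pi}. (1 + (sqrt x)\<^sup>2 + 2 * sqrt x * cos (t - \<phi>)) powr (-m)) = 2 * pi * S"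
      by (rule sums_unique2)
    thus ?thesis by (simp only: set_integral_mult_right)
  qed
  finally have int: "(LBINT t:{0..2*pi}. (p + q * cos (t - \<phi>)) powr (-m)) = R powr (-m) * (2 * pi * S)" .
  have "legendre_P (m - 1) (p / d) = (R / d) powr (-m) * S"
  proof -
    \<comment> \<open>The hypergeometric argument in \<open>legendre_P\<close>. Being nonpositive it
      lies in the half-plane of Pfaff's transformation, which sends it to exactly \<open>x\<close>,
      with prefactor base \<open>1 - u = R / d\<close>.\<close>
    define u where "u = (1 - p / d) / 2"
    have u: "u \<le> 0" "1 - u = R / d" using d \<open>d \<le> p\<close> by (auto simp: u_def R_def field_simps)
    have ux: "u / (u - 1) = x"
      using d \<open>d \<le> p\<close> by (simp add: u_def x_def divide_simps) (simp add: algebra_simps)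
    have "legendre_P (m - 1) (p / d) = Re (hyp2F1 (1 - of_real m) (of_real m) 1 (of_real u))"
      by (simp add: legendre_P_def u_def)
    also have "\<dots> = Re ((1 - of_real u) powr (- of_real m) *
        eval_fps (gbinomial_square_fps (- of_real m)) (of_real u / (of_real u - 1)))"
      using u by (subst hyp2F1_pfaff) auto
    also have "of_real u / (of_real u - 1) = complex_of_real x" by (simp flip: ux)
    also have "eval_fps (gbinomial_square_fps (- of_real m)) (complex_of_real x) = of_real S"
      using eval_gbinomial_square_fps_of_real[OF x, of "-m"] by (simp add: S_def)
    also have "(1 - complex_of_real u) powr (- of_real m) = of_real ((1 - u) powr (-m))"
      using powr_of_real[of "1 - u" "-m"] u(1) by simp
    finally show ?thesis by (simp add: u)
  qed
  moreover have "(p\<^sup>2 - q\<^sup>2) powr (-m/2) = d powr (-m)"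
    using pq by (simp add: d_def powr_half_sqrt[symmetric] powr_powr)
  moreover have "d powr (-m) * (R / d) powr (-m) = R powr (-m)"
    using d R by (simp add: powr_divide)
  ultimately show ?thesis unfolding int d_def[symmetric] by simp
qed

section \<open>Gamma and Gaussian integrals\<close>

lemma nn_integral_powr_exp:
  fixes c s :: real
  assumes "c > 0" "s > 0"
  shows "(\<integral>\<^sup>+t. ennreal (indicator {0<..} t * (t powr (s - 1) * exp (- (c * t)))) \<partial>lborel) = ennreal (Gamma s * c powr (-s))"
proof -
  let ?f = "\<lambda>t::real. ennreal (indicator {0..} t * t powr (s - 1) / exp t)"
  have "ennreal (Gamma s) = (\<integral>\<^sup>+t. ?f t \<partial>lborel)"
    by (rule Gamma_conv_nn_integral_real[OF assms(2)])
  also have "\<dots> = ennreal c * (\<integral>\<^sup>+t. ?f (0 + c * t) \<partial>lborel)"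
    using assms by (subst nn_integral_real_affine[of _ c 0]) auto
  also have "(\<lambda>t. ?f (0 + c * t)) =
      (\<lambda>t. ennreal (c powr (s - 1)) * ennreal (indicator {0<..} t * (t powr (s - 1) * exp (- (c * t)))))"
    using assms by (auto simp: fun_eq_iff indicator_def zero_le_mult_iff powr_mult exp_minus field_simps simp flip: ennreal_mult')
  also have "(\<integral>\<^sup>+t. ennreal (c powr (s - 1)) * ennreal (indicator {0<..} t * (t powr (s - 1) * exp (- (c * t)))) \<partial>lborel) =
      ennreal (c powr (s - 1)) * (\<integral>\<^sup>+t. ennreal (indicator {0<..} t * (t powr (s - 1) * exp (- (c * t)))) \<partial>lborel)"
    by (rule nn_integral_cmult) auto
  finally have "ennreal (Gamma s) = ennreal (c powr s) * (\<integral>\<^sup>+t. ennreal (indicator {0<..} t * (t powr (s - 1) * exp (- (c * t)))) \<partial>lborel)"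
    using assms by (simp add: mult.assoc[symmetric] ennreal_mult'[symmetric] powr_diff)
  \<comment> \<open>The integral is isolated in \<open>ennreal\<close> by multiplying with the
    finite factor \<open>c powr (-s)\<close>.\<close>
  hence "ennreal (c powr (-s)) * ennreal (Gamma s) =
      ennreal (c powr (-s) * c powr s) * (\<integral>\<^sup>+t. ennreal (indicator {0<..} t * (t powr (s - 1) * exp (- (c * t)))) \<partial>lborel)"
    by (simp add: ennreal_mult' mult.assoc)
  also have "c powr (-s) * c powr s = 1" using assms by (simp add: powr_minus)
  finally show ?thesis using Gamma_real_pos[OF assms(2)] by (simp add: ennreal_mult' mult.commute)
qed

text \<open>This is the Laplace transform (1 + w/m)^(-m) of the unit-mean gamma law, with
  \<open>m powr m\<close> split off as in the BER formula.\<close>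

lemma nn_integral_unit_mean_gamma_exp:
  assumes "m > 0" "w \<ge> 0"
  shows "(\<integral>\<^sup>+u. ennreal (unit_mean_gamma_density m u) * ennreal (exp (- (u * w))) \<partial>lborel) =
    ennreal (m powr m * (m + w) powr (-m))"
proof -
  have "(\<integral>\<^sup>+u. ennreal (unit_mean_gamma_density m u) * ennreal (exp (- (u * w))) \<partial>lborel) =
     (\<integral>\<^sup>+u. ennreal (m powr m / Gamma m) * ennreal (indicator {0<..} u * (u powr (m - 1) * exp (- ((m + w) * u)))) \<partial>lborel)"
    using Gamma_real_pos[OF assms(1)]
    by (intro nn_integral_cong)
       (auto simp: unit_mean_gamma_density_def indicator_def exp_add[symmetric] algebra_simps simp flip: ennreal_mult')
  also have "\<dots> = ennreal (m powr m / Gamma m) * ennreal (Gamma m * (m + w) powr (-m))"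
    using assms by (simp add: nn_integral_cmult nn_integral_powr_exp)
  also have "\<dots> = ennreal (m powr m * (m + w) powr (-m))"
    using Gamma_real_pos[OF assms(1)] by (simp flip: ennreal_mult')
  finally show ?thesis .
qed

section \<open>Gaussian probability of a disc\<close>

lemma exp_neg_half_square_lipschitz:
  fixes s t :: real
  shows "\<bar>exp (- s\<^sup>2 / 2) - exp (- t\<^sup>2 / 2)\<bar> \<le> \<bar>s - t\<bar>"
proof -
  have "norm (exp (- s\<^sup>2 / 2) - exp (- t\<^sup>2 / 2)) \<le> 1 * norm (s - t)"
  proof (rule field_differentiable_bound[where S = UNIV and f = "\<lambda>x. exp (- x\<^sup>2 / 2)" and f' = "\<lambda>x. - x * exp (- x\<^sup>2 / 2)"])
    fix z :: real
    show "((\<lambda>x. exp (- x\<^sup>2 / 2)) has_field_derivative - z * exp (- z\<^sup>2 / 2)) (at z within UNIV)"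
      by (auto intro!: derivative_eq_intros)
    \<comment> \<open>This makes the derivative at most 1 in modulus; it is a rearrangement of
      \<open>(\<bar>z\<bar> - 1)\<^sup>2 \<ge> 0\<close>.\<close>
    have "\<bar>z\<bar> \<le> 1 + z\<^sup>2 / 2"
      using zero_le_power2[of "\<bar>z\<bar> - 1"] by (simp add: power2_diff)
    also have "\<dots> \<le> exp (z\<^sup>2 / 2)" by (rule exp_ge_add_one_self)
    finally show "norm (- z * exp (- z\<^sup>2 / 2)) \<le> 1"
      by (simp add: abs_mult exp_minus field_simps)
  qed auto
  thus ?thesis by simp
qed

text \<open>On the disc of radius \<open>sqrt c\<close> about \<open>(- a, - b)\<close> the Gaussian
  profile differs from its value at the centre by at most \<open>sqrt c / \<sigma>\<close>; the area
  \<open>pi * c\<close> and the normalisation give the bound. The real witness \<open>g\<close>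
  records finiteness together with the estimate.\<close>

lemma gaussian_disc_probability:
  fixes a b c \<sigma> :: real
  assumes \<sigma>: "\<sigma> > 0" and c: "c \<ge> 0"
  defines "N \<equiv> density lborel (\<lambda>x. ennreal (normal_density 0 \<sigma> x))"
  obtains g where "(\<integral>\<^sup>+x. \<integral>\<^sup>+y. indicator {..c} ((a + x)\<^sup>2 + (b + y)\<^sup>2) \<partial>N \<partial>N) = ennreal g" "g \<ge> 0"
    "\<bar>\<sigma>\<^sup>2 * g - c / 2 * exp (- ((a\<^sup>2 + b\<^sup>2) / (2 * \<sigma>\<^sup>2)))\<bar> \<le> c * sqrt c / (2 * \<sigma>)"
proof -
  \<comment> \<open>The joint Gaussian density without its factor
    \<open>1 / (2 * pi * \<sigma>\<^sup>2)\<close>. It is radial, so its value at the centre of the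
    disc can be written \<open>e (a, b)\<close>.\<close>
  define e where "e = (\<lambda>z :: real \<times> real. exp (- (norm z / \<sigma>)\<^sup>2 / 2))"
  define B where "B = cball (- a, - b) (sqrt c)"
  have [measurable]: "e \<in> borel_measurable borel" unfolding e_def by measurable
  have [measurable]: "B \<in> sets borel" unfolding B_def by simp
  have norm_z: "(norm z)\<^sup>2 = (fst z)\<^sup>2 + (snd z)\<^sup>2" for z :: "real \<times> real"
    by (cases z) (simp add: norm_Pair)
  have inB: "z \<in> B \<longleftrightarrow> (a + fst z)\<^sup>2 + (b + snd z)\<^sup>2 \<le> c" for z
    by (cases z) (simp add: B_def dist_norm norm_Pair real_sqrt_le_iff power2_eq_square algebra_simps)
  have dens: "normal_density 0 \<sigma> x * normal_density 0 \<sigma> y = 1 / (2 * pi * \<sigma>\<^sup>2) * e (x, y)" for x y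
  proof -
    have "exp (- (x\<^sup>2 / (2 * \<sigma>\<^sup>2))) * exp (- (y\<^sup>2 / (2 * \<sigma>\<^sup>2))) = e (x, y)"
      by (simp add: e_def norm_z power_divide add_divide_distrib mult.commute flip: exp_add)
    moreover have "sqrt (2 * pi * \<sigma>\<^sup>2) * sqrt (2 * pi * \<sigma>\<^sup>2) = 2 * pi * \<sigma>\<^sup>2"
      by simp
    ultimately show ?thesis
      unfolding normal_density_def by (simp add: divide_simps) 
  qed
  have areaB: "emeasure lborel B = ennreal (pi * c)"
    using c by (simp add: B_def emeasure_cball unit_ball_vol_2)
  have int: "integrable lborel (\<lambda>z. indicator B z * e z)"
  proof (rule integrableI_bounded_set_indicator[where B = 1, of B lborel e, simplified])
    show "emeasure lborel B < \<top>" by (simp add: areaB)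
    show "AE x in lborel. x \<in> B \<longrightarrow> \<bar>e x\<bar> \<le> 1" by (simp add: e_def)
  qed measurable
  define J where "J = (LINT z|lborel. indicator B z * e z)"
  define g where "g = 1 / (2 * pi * \<sigma>\<^sup>2) * J"
  have "J \<ge> 0" unfolding J_def by (intro integral_nonneg_AE) (auto simp: e_def)
  have inner: "(\<integral>\<^sup>+y. indicator {..c} ((a + x)\<^sup>2 + (b + y)\<^sup>2) \<partial>N) =
      (\<integral>\<^sup>+y. ennreal (normal_density 0 \<sigma> y) * indicator {..c} ((a + x)\<^sup>2 + (b + y)\<^sup>2) \<partial>lborel)" for x
    unfolding N_def by (rule nn_integral_density) measurable
  have "(\<integral>\<^sup>+x. \<integral>\<^sup>+y. indicator {..c} ((a + x)\<^sup>2 + (b + y)\<^sup>2) \<partial>N \<partial>N) =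
      (\<integral>\<^sup>+x. ennreal (normal_density 0 \<sigma> x) *
        (\<integral>\<^sup>+y. ennreal (normal_density 0 \<sigma> y) * indicator {..c} ((a + x)\<^sup>2 + (b + y)\<^sup>2) \<partial>lborel) \<partial>lborel)"
    unfolding inner unfolding N_def by (rule nn_integral_density) measurable
  also have "\<dots> = (\<integral>\<^sup>+x. \<integral>\<^sup>+y. ennreal (1 / (2 * pi * \<sigma>\<^sup>2)) * ennreal (indicator B (x, y) * e (x, y)) \<partial>lborel \<partial>lborel)"
  proof (rule nn_integral_cong)
    fix x
    have "ennreal (normal_density 0 \<sigma> x) *
        (\<integral>\<^sup>+y. ennreal (normal_density 0 \<sigma> y) * indicator {..c} ((a + x)\<^sup>2 + (b + y)\<^sup>2) \<partial>lborel) =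
        (\<integral>\<^sup>+y. ennreal (normal_density 0 \<sigma> x) * (ennreal (normal_density 0 \<sigma> y) * indicator {..c} ((a + x)\<^sup>2 + (b + y)\<^sup>2)) \<partial>lborel)"
      by (rule nn_integral_cmult[symmetric]) measurable
    also have "\<dots> = (\<integral>\<^sup>+y. ennreal (1 / (2 * pi * \<sigma>\<^sup>2)) * ennreal (indicator B (x, y) * e (x, y)) \<partial>lborel)"
    proof (rule nn_integral_cong)
      fix y
      have "ennreal (normal_density 0 \<sigma> x) * ennreal (normal_density 0 \<sigma> y) =
          ennreal (1 / (2 * pi * \<sigma>\<^sup>2)) * ennreal (e (x, y))"
        by (subst (1 2) ennreal_mult[symmetric]) (simp_all only: dens, simp_all add: e_def)
      thus "ennreal (normal_density 0 \<sigma> x) * (ennreal (normal_density 0 \<sigma> y) * indicator {..c} ((a + x)\<^sup>2 + (b + y)\<^sup>2)) =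
          ennreal (1 / (2 * pi * \<sigma>\<^sup>2)) * ennreal (indicator B (x, y) * e (x, y))"
        by (simp add: indicator_def inB mult.assoc[symmetric])
    qed
    finally show "ennreal (normal_density 0 \<sigma> x) *
        (\<integral>\<^sup>+y. ennreal (normal_density 0 \<sigma> y) * indicator {..c} ((a + x)\<^sup>2 + (b + y)\<^sup>2) \<partial>lborel) =
        (\<integral>\<^sup>+y. ennreal (1 / (2 * pi * \<sigma>\<^sup>2)) * ennreal (indicator B (x, y) * e (x, y)) \<partial>lborel)" .
  qed
  also have "\<dots> = (\<integral>\<^sup>+z. ennreal (1 / (2 * pi * \<sigma>\<^sup>2)) * ennreal (indicator B z * e z) \<partial>(lborel \<Otimes>\<^sub>M lborel))"
    by (rule lborel.nn_integral_fst) (simp add: lborel_prod)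
  also have "\<dots> = ennreal (1 / (2 * pi * \<sigma>\<^sup>2)) * ennreal J"
    unfolding lborel_prod J_def
    by (subst nn_integral_cmult, simp, subst nn_integral_eq_integral[OF int]) (auto simp: e_def)
  also have "\<dots> = ennreal g"
    using \<open>J \<ge> 0\<close> by (simp add: g_def flip: ennreal_mult')
  finally have eq: "(\<integral>\<^sup>+x. \<integral>\<^sup>+y. indicator {..c} ((a + x)\<^sup>2 + (b + y)\<^sup>2) \<partial>N \<partial>N) = ennreal g" .
  \<comment> \<open>\<open>(a, b)\<close> is the reflected centre of \<open>B\<close> and has the
    same norm. The Lipschitz bound and the reverse triangle inequality turn the radius into the
    error.\<close>
  have e_near: "\<bar>e z - e (a, b)\<bar> \<le> sqrt c / \<sigma>" if "z \<in> B" for z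
  proof -
    have "\<bar>e z - e (a, b)\<bar> \<le> \<bar>norm z / \<sigma> - norm (a, b) / \<sigma>\<bar>"
      unfolding e_def by (rule exp_neg_half_square_lipschitz)
    also have "\<dots> = \<bar>norm z - norm (- (a, b))\<bar> / \<sigma>"
      using \<sigma> by (simp add: diff_divide_distrib[symmetric] abs_divide del: uminus_Pair)
    also have "\<dots> \<le> norm (z - (- (a, b))) / \<sigma>"
      using \<sigma> by (intro divide_right_mono norm_triangle_ineq3) auto
    also have "\<dots> \<le> sqrt c / \<sigma>"
      using that \<sigma> by (intro divide_right_mono) (auto simp: B_def dist_norm norm_minus_commute)
    finally show ?thesis .
  qed
  have intB: "integrable lborel (\<lambda>z. k * indicator B z :: real)" for k
    by (intro integrable_mult_right integrable_real_indicator) (simp_all add: areaB)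
  have "\<bar>J - e (a, b) * (pi * c)\<bar> \<le> sqrt c / \<sigma> * (pi * c)"
  proof -
    have mB: "measure lborel B = pi * c" using areaB c by (simp add: measure_def)
    have "J - e (a, b) * (pi * c) = (LINT z|lborel. indicator B z * e z - e (a, b) * indicator B z)"
      unfolding J_def by (subst Bochner_Integration.integral_diff[OF int intB]) (simp add: mB)
    also have "\<bar>\<dots>\<bar> \<le> (LINT z|lborel. \<bar>indicator B z * e z - e (a, b) * indicator B z\<bar>)"
      by (rule integral_abs_bound)
    also have "\<dots> \<le> (LINT z|lborel. sqrt c / \<sigma> * indicator B z)"
      using e_near by (intro integral_mono integrable_abs Bochner_Integration.integrable_diff int intB) (auto simp: indicator_def)
    also have "\<dots> = sqrt c / \<sigma> * (pi * c)" by (simp add: mB)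
    finally show ?thesis .
  qed
  \<comment> \<open>Division by \<open>2 * pi\<close> turns \<open>J\<close> into
    \<open>\<sigma>\<^sup>2 * g\<close> and the area into \<open>c / 2\<close>.\<close>
  hence "\<bar>J - e (a, b) * (pi * c)\<bar> / (2 * pi) \<le> sqrt c / \<sigma> * (pi * c) / (2 * pi)"
    by (intro divide_right_mono) auto
  also have "sqrt c / \<sigma> * (pi * c) / (2 * pi) = c * sqrt c / (2 * \<sigma>)" by (simp add: mult_ac)
  also have "\<bar>J - e (a, b) * (pi * c)\<bar> / (2 * pi) = \<bar>\<sigma>\<^sup>2 * g - c / 2 * e (a, b)\<bar>"
  proof -
    have "\<sigma>\<^sup>2 * g - c / 2 * e (a, b) = (J - e (a, b) * (pi * c)) / (2 * pi)"
      using \<sigma> by (simp add: g_def field_simps)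
    thus ?thesis by (simp add: abs_divide)
  qed
  also have "e (a, b) = exp (- ((a\<^sup>2 + b\<^sup>2) / (2 * \<sigma>\<^sup>2)))"
    by (simp add: e_def norm_z power_divide mult.commute)
  finally have "\<bar>\<sigma>\<^sup>2 * g - c / 2 * exp (- ((a\<^sup>2 + b\<^sup>2) / (2 * \<sigma>\<^sup>2)))\<bar> \<le> c * sqrt c / (2 * \<sigma>)" .
  moreover have "g \<ge> 0" using \<open>J \<ge> 0\<close> by (simp add: g_def)
  ultimately show ?thesis using that eq by blast
qed

section \<open>The FTR channel\<close>

text \<open>The coordinates are peeled off in the order 1, 2, 0, 3, 4. This puts the noise
  innermost, then the gamma variable, then the phases, the order in which they are averaged
  later.\<close>

lemma nn_integral_PiM_five:
  fixes D :: "nat \<Rightarrow> real measure"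
  assumes D: "\<And>i. prob_space (D i)" and sets_D: "\<And>i. sets (D i) = sets borel"
    and H: "H \<in> borel_measurable (borel \<Otimes>\<^sub>M borel \<Otimes>\<^sub>M borel \<Otimes>\<^sub>M borel \<Otimes>\<^sub>M borel)"
  shows "(\<integral>\<^sup>+x. H (x 0, x 1, x 2, x 3, x 4) \<partial>PiM {0, 1, 2, 3, 4} D) =
    (\<integral>\<^sup>+p1. \<integral>\<^sup>+p2. \<integral>\<^sup>+z. \<integral>\<^sup>+x. \<integral>\<^sup>+y. H (z, p1, p2, x, y) \<partial>D 4 \<partial>D 3 \<partial>D 0 \<partial>D 2 \<partial>D 1)"
proof -
  interpret product_prob_space D
    using D by (intro product_prob_spaceI)
  have comp [measurable]: "(\<lambda>x. x i) \<in> borel_measurable (PiM I D)" if "i \<in> I" for i I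
    using measurable_component_singleton[OF that, of D] measurable_cong_sets[OF refl sets_D] by blast
  note [measurable] = H
  have eq: "{0, 1, 2, 3, 4} = insert 1 {0, 2, 3, 4 :: nat}" "{0, 2, 3, 4} = insert 2 {0, 3, 4 :: nat}" by auto
  have "(\<integral>\<^sup>+x. H (x 0, x 1, x 2, x 3, x 4) \<partial>PiM {0, 1, 2, 3, 4} D) =
      (\<integral>\<^sup>+p1. \<integral>\<^sup>+x. H (x 0, p1, x 2, x 3, x 4) \<partial>PiM {0, 2, 3, 4} D \<partial>D 1)"
    unfolding eq(1) by (subst product_nn_integral_insert_rev) (simp_all, measurable)
  also have "\<dots> = (\<integral>\<^sup>+p1. \<integral>\<^sup>+p2. \<integral>\<^sup>+x. H (x 0, p1, p2, x 3, x 4) \<partial>PiM {0, 3, 4} D \<partial>D 2 \<partial>D 1)"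
    unfolding eq(2) by (subst product_nn_integral_insert_rev) (simp_all, measurable)
  also have "\<dots> = (\<integral>\<^sup>+p1. \<integral>\<^sup>+p2. \<integral>\<^sup>+z. \<integral>\<^sup>+x. H (z, p1, p2, x 3, x 4) \<partial>PiM {3, 4} D \<partial>D 0 \<partial>D 2 \<partial>D 1)"
    by (subst product_nn_integral_insert_rev) (simp_all, measurable)
  also have "\<dots> = (\<integral>\<^sup>+p1. \<integral>\<^sup>+p2. \<integral>\<^sup>+z. \<integral>\<^sup>+u. \<integral>\<^sup>+x. H (z, p1, p2, u, x 4) \<partial>PiM {4} D \<partial>D 3 \<partial>D 0 \<partial>D 2 \<partial>D 1)"
    by (subst product_nn_integral_insert_rev) (simp_all, measurable)
  also have "\<dots> = (\<integral>\<^sup>+p1. \<integral>\<^sup>+p2. \<integral>\<^sup>+z. \<integral>\<^sup>+x. \<integral>\<^sup>+y. H (z, p1, p2, x, y) \<partial>D 4 \<partial>D 3 \<partial>D 0 \<partial>D 2 \<partial>D 1)"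
    by (subst product_nn_integral_singleton) (simp_all add: measurable_cong_sets[OF sets_D refl])
  finally show ?thesis .
qed

section \<open>Joint law of the gamma variable, the phases and the noise\<close>

context ftr_channel
begin

abbreviation "zeta_law \<equiv> density lborel (\<lambda>u. ennreal (unit_mean_gamma_density m u))"
abbreviation "phase_law \<equiv> density lborel (\<lambda>x. ennreal (indicator {0..<2*pi} x / (2*pi)))"
abbreviation "noise_law \<equiv> density lborel (\<lambda>x. ennreal (normal_density 0 \<sigma> x))"

text \<open>Reconciles the densities, stated over \<open>lborel\<close>, with independence, stated
  over \<open>borel\<close>; the measurable sets are the same.\<close>

lemma distributed_lborel:
  fixes Z :: "'a \<Rightarrow> real"
  assumes "distributed M lborel Z f"
  shows "Z \<in> borel_measurable M" and "distr M borel Z = density lborel f"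
proof -
  show "Z \<in> borel_measurable M" using assms by (simp add: distributed_def)
  have "distr M borel Z = distr M lborel Z" by (rule distr_cong) auto
  thus "distr M borel Z = density lborel f" by (simp only: distributed_distr_eq_density[OF assms])
qed

lemmas components_measurable [measurable] =
  zeta_distr[THEN distributed_lborel(1)] phi1_distr[THEN distributed_lborel(1)] phi2_distr[THEN distributed_lborel(1)]
  X_distr[THEN distributed_lborel(1)] Y_distr[THEN distributed_lborel(1)]

lemmas components_law =
  zeta_distr[THEN distributed_lborel(2)] phi1_distr[THEN distributed_lborel(2)] phi2_distr[THEN distributed_lborel(2)]
  X_distr[THEN distributed_lborel(2)] Y_distr[THEN distributed_lborel(2)]

lemma prob_space_laws: "prob_space zeta_law" "prob_space phase_law" "prob_space noise_law"
  by (rule prob_space_distr[OF components_measurable(1), unfolded components_law(1)],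
      rule prob_space_distr[OF components_measurable(2), unfolded components_law(2)],
      rule prob_space_distr[OF components_measurable(4), unfolded components_law(4)])

text \<open>Independence identifies the joint law with a product measure, so an expectation becomes
  an iterated integral.\<close>

lemma nn_integral_components:
  assumes "H \<in> borel_measurable (borel \<Otimes>\<^sub>M borel \<Otimes>\<^sub>M borel \<Otimes>\<^sub>M borel \<Otimes>\<^sub>M borel)"
  shows "(\<integral>\<^sup>+\<omega>. H (\<zeta> \<omega>, \<phi>1 \<omega>, \<phi>2 \<omega>, X \<omega>, Y \<omega>) \<partial>M) =
    (\<integral>\<^sup>+p1. \<integral>\<^sup>+p2. \<integral>\<^sup>+z. \<integral>\<^sup>+x. \<integral>\<^sup>+y. H (z, p1, p2, x, y) \<partial>noise_law \<partial>noise_law \<partial>zeta_law \<partial>phase_law \<partial>phase_law)"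
proof -
  define W where "W = (\<lambda>i. [\<zeta>, \<phi>1, \<phi>2, X, Y] ! i)"
  define D where "D = (\<lambda>i::nat. if i = 0 then zeta_law else if i < 3 then phase_law else noise_law)"
  have I: "{..<5} = {0, 1, 2, 3, 4 :: nat}" by auto
  have W: "W 0 = \<zeta>" "W 1 = \<phi>1" "W 2 = \<phi>2" "W 3 = X" "W 4 = Y"
    by (simp_all add: W_def numeral_2_eq_2 numeral_3_eq_3 eval_nat_numeral)
  have rv: "random_variable borel (W i)" if "i \<in> {..<5}" for i
    using that unfolding I by (auto simp: W W(2)[simplified])
  have "indep_vars (\<lambda>_. borel) W {..<5}" using indep by (simp add: W_def)
  hence "distr M (Pi\<^sub>M {..<5} (\<lambda>_. borel)) (\<lambda>x. \<lambda>i\<in>{..<5}. W i x) = Pi\<^sub>M {..<5} (\<lambda>i. distr M borel (W i))"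
    by (rule indep_vars_iff_distr_eq_PiM'[THEN iffD1, rotated 2]) (use rv in \<open>auto simp: I\<close>)
  also have "\<dots> = Pi\<^sub>M {..<5} D"
    by (rule PiM_cong) (auto simp: I D_def W W(2)[simplified] components_law)
  finally have distr: "distr M (Pi\<^sub>M {..<5} (\<lambda>_. borel)) (\<lambda>x. \<lambda>i\<in>{..<5}. W i x) = Pi\<^sub>M {..<5} D" .
  have [measurable]: "(\<lambda>x. \<lambda>i\<in>{..<5}. W i x) \<in> measurable M (Pi\<^sub>M {..<5} (\<lambda>_. borel))"
    by (intro measurable_restrict) (auto simp: I W W(2)[simplified])
  note [measurable] = assms
  have "(\<integral>\<^sup>+\<omega>. H (\<zeta> \<omega>, \<phi>1 \<omega>, \<phi>2 \<omega>, X \<omega>, Y \<omega>) \<partial>M) =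
      (\<integral>\<^sup>+x. H (x 0, x 1, x 2, x 3, x 4) \<partial>distr M (Pi\<^sub>M {..<5} (\<lambda>_. borel)) (\<lambda>x. \<lambda>i\<in>{..<5}. W i x))"
    by (subst nn_integral_distr) (auto simp: W W(2)[simplified])
  also have "\<dots> = (\<integral>\<^sup>+p1. \<integral>\<^sup>+p2. \<integral>\<^sup>+z. \<integral>\<^sup>+x. \<integral>\<^sup>+y. H (z, p1, p2, x, y) \<partial>D 4 \<partial>D 3 \<partial>D 0 \<partial>D 2 \<partial>D 1)"
    unfolding distr unfolding I by (rule nn_integral_PiM_five[OF _ _ assms]) (auto simp: D_def prob_space_laws)
  finally show ?thesis by (simp add: D_def)
qed

end

section \<open>Averaging over a uniform phase\<close>

lemma laplace_integral_cos_pos: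
  fixes p q m \<phi> :: real
  assumes "0 \<le> q" "q < p" "m > 0"
  shows "integrable lborel (\<lambda>t. indicator {0..2*pi} t * (p + q * cos (t - \<phi>)) powr (-m))"
    and "0 < (LBINT t:{0..2*pi}. (p + q * cos (t - \<phi>)) powr (-m))"
proof -
  have pos: "p + q * cos t > 0" for t
    using mult_left_mono[OF cos_ge_minus_one[of t] assms(1)] assms(2) by simp
  have le: "p + q * cos t \<le> p + q" for t
    using mult_left_mono[OF cos_le_one[of t] assms(1)] by simp
  have "continuous_on {0..2*pi} (\<lambda>t. (p + q * cos (t - \<phi>)) powr (-m))"
    using pos by (intro continuous_intros) (auto simp: less_imp_neq[symmetric])
  from borel_integrable_compact[OF compact_Icc this]
  show int: "integrable lborel (\<lambda>t. indicator {0..2*pi} t * (p + q * cos (t - \<phi>)) powr (-m))"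
    by simp
  \<comment> \<open>\<open>p + q\<close> is the largest value of the base and the exponent is
    negative, so this constant bounds the integrand from below.\<close>
  have "0 < (p + q) powr (-m) * (2 * pi)" using assms by simp
  also have "\<dots> = (LBINT t. indicator {0..2*pi} t * (p + q) powr (-m))" by simp
  also have "\<dots> \<le> (LBINT t. indicator {0..2*pi} t * (p + q * cos (t - \<phi>)) powr (-m))"
  proof (rule integral_mono[OF _ int])
    show "integrable lborel (\<lambda>t. indicator {0..2*pi} t * (p + q) powr (-m))" by simp
    show "indicator {0..2*pi} t * (p + q) powr (-m) \<le> indicator {0..2*pi} t * (p + q * cos (t - \<phi>)) powr (-m)" for t
      using pos[of "t - \<phi>"] le[of "t - \<phi>"] assms by (intro mult_left_mono powr_mono2') auto
  qed
  finally show "0 < (LBINT t:{0..2*pi}. (p + q * cos (t - \<phi>)) powr (-m))"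
    by (simp add: set_lebesgue_integral_def)
qed

lemma nn_integral_phase:
  fixes p q m \<phi> :: real
  assumes "0 \<le> q" "q < p" "m > 0"
  shows "(\<integral>\<^sup>+t. ennreal ((p + q * cos (t - \<phi>)) powr (-m))
      \<partial>density lborel (\<lambda>x. ennreal (indicator {0..<2*pi} x / (2*pi)))) =
    ennreal ((p\<^sup>2 - q\<^sup>2) powr (-m/2) * legendre_P (m - 1) (p / sqrt (p\<^sup>2 - q\<^sup>2)))"
proof -
  have "(\<integral>\<^sup>+t. ennreal ((p + q * cos (t - \<phi>)) powr (-m))
      \<partial>density lborel (\<lambda>x. ennreal (indicator {0..<2*pi} x / (2*pi)))) =
      (\<integral>\<^sup>+t. ennreal (indicator {0..<2*pi} t / (2*pi)) * ennreal ((p + q * cos (t - \<phi>)) powr (-m)) \<partial>lborel)"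
    by (rule nn_integral_density) measurable
  \<comment> \<open>The phase law lives on a half-open period and Laplace's integral on the closed
    one; the endpoint is a null set.\<close>
  also have "\<dots> = (\<integral>\<^sup>+t. ennreal (1 / (2*pi)) * ennreal (indicator {0..2*pi} t * (p + q * cos (t - \<phi>)) powr (-m)) \<partial>lborel)"
  proof (rule nn_integral_cong_AE)
    show "AE t in lborel. ennreal (indicator {0..<2*pi} t / (2*pi)) * ennreal ((p + q * cos (t - \<phi>)) powr (-m)) =
        ennreal (1 / (2*pi)) * ennreal (indicator {0..2*pi} t * (p + q * cos (t - \<phi>)) powr (-m))"
      using AE_lborel_singleton[of "2*pi"] by eventually_elim (auto simp: indicator_def)
  qed
  also have "\<dots> = ennreal (1 / (2*pi)) * ennreal (LBINT t:{0..2*pi}. (p + q * cos (t - \<phi>)) powr (-m))"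
    using laplace_integral_cos_pos[OF assms, of \<phi>]
    by (simp add: nn_integral_cmult nn_integral_eq_integral set_lebesgue_integral_def)
  also have "\<dots> = ennreal ((p\<^sup>2 - q\<^sup>2) powr (-m/2) * legendre_P (m - 1) (p / sqrt (p\<^sup>2 - q\<^sup>2)))"
    unfolding laplace_integral_legendre_P[OF assms(1,2)] by (simp flip: ennreal_mult')
  finally show ?thesis .
qed

section \<open>The specular component and its exponential mean\<close>

context ftr_channel
begin

abbreviation "K \<equiv> ftr_K \<sigma> V1 V2"
abbreviation "\<Delta> \<equiv> ftr_Delta V1 V2"

abbreviation "specular_re z p1 p2 \<equiv> sqrt z * (V1 * cos p1 + V2 * cos p2)"
abbreviation "specular_im z p1 p2 \<equiv> sqrt z * (V1 * sin p1 + V2 * sin p2)"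

text \<open>Supplies the hypotheses of Laplace's integral for \<open>p = m + K\<close> and
  \<open>q = K * \<Delta>\<close>. The bound \<open>\<Delta> \<le> 1\<close> is
  \<open>(V1 - V2)\<^sup>2 \<ge> 0\<close>.\<close>

lemma K_Delta_bounds: "0 < K" "0 \<le> K * \<Delta>" "K * \<Delta> < m + K"
proof -
  have V: "V1\<^sup>2 + V2\<^sup>2 > 0" using V_not_both_zero by (simp add: sum_power2_gt_zero_iff)
  show K: "0 < K" unfolding ftr_K_def using V sigma_pos by simp
  have "0 \<le> \<Delta>" "\<Delta> \<le> 1"
    unfolding ftr_Delta_def using V V1_nonneg V2_nonneg zero_le_power2[of "V1 - V2"]
    by (auto simp: power2_diff)
  thus "0 \<le> K * \<Delta>" "K * \<Delta> < m + K"
    using K m_pos mult_left_le[of \<Delta> K] by (simp_all, linarith)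
qed

text \<open>Relative to the noise power, only \<open>K\<close> and \<open>\<Delta>\<close> remain,
  which is why the limiting constant is free of \<sigma>. The absolute value arises because
  \<open>sqrt\<close> is odd on the reals, so \<open>(sqrt z)\<^sup>2 = \<bar>z\<bar>\<close> for
  every \<open>z\<close>.\<close>

lemma specular_power:
  "((specular_re z p1 p2)\<^sup>2 + (specular_im z p1 p2)\<^sup>2) / (2 * \<sigma>\<^sup>2) = \<bar>z\<bar> * (K + K * \<Delta> * cos (p2 - p1))"
proof -
  have V: "V1\<^sup>2 + V2\<^sup>2 > 0" using V_not_both_zero by (simp add: sum_power2_gt_zero_iff)
  have z2: "(sqrt z)\<^sup>2 = \<bar>z\<bar>" by (simp add: power2_eq_square)
  have "(specular_re z p1 p2)\<^sup>2 + (specular_im z p1 p2)\<^sup>2 =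
      \<bar>z\<bar> * ((V1 * cos p1 + V2 * cos p2)\<^sup>2 + (V1 * sin p1 + V2 * sin p2)\<^sup>2)"
    by (simp only: power_mult_distrib z2 distrib_left[of "\<bar>z\<bar>"])
  also have "(V1 * cos p1 + V2 * cos p2)\<^sup>2 + (V1 * sin p1 + V2 * sin p2)\<^sup>2 =
      V1\<^sup>2 * ((cos p1)\<^sup>2 + (sin p1)\<^sup>2) + V2\<^sup>2 * ((cos p2)\<^sup>2 + (sin p2)\<^sup>2) +
        2 * V1 * V2 * (cos p2 * cos p1 + sin p2 * sin p1)"
    by algebra
  also have "\<dots> = V1\<^sup>2 + V2\<^sup>2 + 2 * V1 * V2 * cos (p2 - p1)"
    by (simp add: cos_diff)
  finally have "((specular_re z p1 p2)\<^sup>2 + (specular_im z p1 p2)\<^sup>2) / (2 * \<sigma>\<^sup>2) =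
      \<bar>z\<bar> * ((V1\<^sup>2 + V2\<^sup>2) / (2 * \<sigma>\<^sup>2) + V1 * V2 / \<sigma>\<^sup>2 * cos (p2 - p1))"
    using sigma_pos by (simp add: field_simps)
  moreover have "K * \<Delta> = V1 * V2 / \<sigma>\<^sup>2"
    using V sigma_pos by (simp add: ftr_K_def ftr_Delta_def)
  ultimately show ?thesis by (simp only: ftr_K_def)
qed

lemma ftr_snr_eq:
  "ftr_snr V1 V2 \<zeta> \<phi>1 \<phi>2 X Y \<omega> =
    (specular_re (\<zeta> \<omega>) (\<phi>1 \<omega>) (\<phi>2 \<omega>) + X \<omega>)\<^sup>2 + (specular_im (\<zeta> \<omega>) (\<phi>1 \<omega>) (\<phi>2 \<omega>) + Y \<omega>)\<^sup>2"
  by (simp add: ftr_snr_def ftr_response_def cmod_power2 cis_conv_exp[symmetric] algebra_simps)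

text \<open>The constant \<open>L\<close> in closed form; \<open>nn_integral_specular\<close>
  identifies it with the mean.\<close>

definition ftr_limit :: real where
  "ftr_limit = m powr m * (((m + K)\<^sup>2 - (K * \<Delta>)\<^sup>2) powr (-m/2) *
     legendre_P (m - 1) ((m + K) / sqrt ((m + K)\<^sup>2 - (K * \<Delta>)\<^sup>2)))"

text \<open>The sign is read off Laplace's integral, whose integrand is positive, instead of the
  hypergeometric definition.\<close>

lemma ftr_limit_pos: "ftr_limit > 0"
proof -
  note * = K_Delta_bounds m_pos
  have "0 < 2 * pi * (((m + K)\<^sup>2 - (K * \<Delta>)\<^sup>2) powr (-m/2) *
     legendre_P (m - 1) ((m + K) / sqrt ((m + K)\<^sup>2 - (K * \<Delta>)\<^sup>2)))"
    using laplace_integral_cos_pos(2)[OF *(2,3,4), of 0] laplace_integral_legendre_P[OF *(2,3), of 0 m] by simp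
  hence "0 < ((m + K)\<^sup>2 - (K * \<Delta>)\<^sup>2) powr (-m/2) *
     legendre_P (m - 1) ((m + K) / sqrt ((m + K)\<^sup>2 - (K * \<Delta>)\<^sup>2))"
    by (rule zero_less_mult_pos) simp
  thus ?thesis unfolding ftr_limit_def using m_pos by simp
qed

lemma nn_integral_noise_const: "(\<integral>\<^sup>+x. \<integral>\<^sup>+y. c \<partial>noise_law \<partial>noise_law) = c"
proof -
  interpret noise: prob_space noise_law by (rule prob_space_laws)
  show ?thesis using noise.emeasure_space_1 by simp
qed

text \<open>The noise integrates to 1, the gamma average is a Laplace transform, and the second
  phase gives Laplace's integral with shift \<open>p1\<close>. Its value is independent of the
  shift, so the last average is over a constant.\<close>

lemma nn_integral_specular:
  "(\<integral>\<^sup>+\<omega>. ennreal (exp (- (((specular_re (\<zeta> \<omega>) (\<phi>1 \<omega>) (\<phi>2 \<omega>))\<^sup>2 +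
      (specular_im (\<zeta> \<omega>) (\<phi>1 \<omega>) (\<phi>2 \<omega>))\<^sup>2) / (2 * \<sigma>\<^sup>2)))) \<partial>M) = ennreal ftr_limit"
proof -
  interpret phase: prob_space phase_law by (rule prob_space_laws)
  have zeta: "(\<integral>\<^sup>+z. ennreal (exp (- (\<bar>z\<bar> * (K + K * \<Delta> * cos (p2 - p1))))) \<partial>zeta_law) =
      ennreal (m powr m) * ennreal ((m + K + K * \<Delta> * cos (p2 - p1)) powr (-m))" for p1 p2
  proof -
    have w: "0 \<le> K + K * \<Delta> * cos (p2 - p1)"
    proof -
      have "\<Delta> \<le> 1" unfolding ftr_Delta_def using zero_le_power2[of "V1 - V2"] V_not_both_zero
        by (auto simp: power2_diff divide_le_eq sum_power2_gt_zero_iff)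
      hence "K * \<Delta> \<le> K" using K_Delta_bounds(1) by simp
      moreover have "K * \<Delta> * (-1) \<le> K * \<Delta> * cos (p2 - p1)"
        using K_Delta_bounds(2) by (intro mult_left_mono) auto
      ultimately show ?thesis by simp
    qed
    have "(\<integral>\<^sup>+z. ennreal (exp (- (\<bar>z\<bar> * (K + K * \<Delta> * cos (p2 - p1))))) \<partial>zeta_law) =
        (\<integral>\<^sup>+z. ennreal (unit_mean_gamma_density m z) * ennreal (exp (- (\<bar>z\<bar> * (K + K * \<Delta> * cos (p2 - p1))))) \<partial>lborel)"
      by (rule nn_integral_density) (unfold unit_mean_gamma_density_def, measurable)
    also have "\<dots> = (\<integral>\<^sup>+z. ennreal (unit_mean_gamma_density m z) * ennreal (exp (- (z * (K + K * \<Delta> * cos (p2 - p1))))) \<partial>lborel)"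
      by (intro nn_integral_cong) (auto simp: unit_mean_gamma_density_def)
    also have "\<dots> = ennreal (m powr m * (m + (K + K * \<Delta> * cos (p2 - p1))) powr (-m))"
      by (rule nn_integral_unit_mean_gamma_exp[OF m_pos w])
    finally show ?thesis by (simp add: ennreal_mult' add.assoc)
  qed
  have "(\<integral>\<^sup>+\<omega>. ennreal (exp (- (((specular_re (\<zeta> \<omega>) (\<phi>1 \<omega>) (\<phi>2 \<omega>))\<^sup>2 +
      (specular_im (\<zeta> \<omega>) (\<phi>1 \<omega>) (\<phi>2 \<omega>))\<^sup>2) / (2 * \<sigma>\<^sup>2)))) \<partial>M) =
      (\<integral>\<^sup>+p1. \<integral>\<^sup>+p2. \<integral>\<^sup>+z. \<integral>\<^sup>+x. \<integral>\<^sup>+y. ennreal (exp (- (((specular_re z p1 p2)\<^sup>2 + (specular_im z p1 p2)\<^sup>2) / (2 * \<sigma>\<^sup>2))))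
        \<partial>noise_law \<partial>noise_law \<partial>zeta_law \<partial>phase_law \<partial>phase_law)"
    using nn_integral_components[of "\<lambda>(z, p1, p2, x, y). ennreal (exp (- (((specular_re z p1 p2)\<^sup>2 +
      (specular_im z p1 p2)\<^sup>2) / (2 * \<sigma>\<^sup>2))))"] by simp
  also have "\<dots> = (\<integral>\<^sup>+p1. \<integral>\<^sup>+p2. ennreal (m powr m) * ennreal ((m + K + K * \<Delta> * cos (p2 - p1)) powr (-m)) \<partial>phase_law \<partial>phase_law)"
    unfolding nn_integral_noise_const specular_power zeta ..
  also have "\<dots> = (\<integral>\<^sup>+p1. ennreal ftr_limit \<partial>phase_law)"
  proof (rule nn_integral_cong)
    fix p1
    have "(\<integral>\<^sup>+p2. ennreal (m powr m) * ennreal ((m + K + K * \<Delta> * cos (p2 - p1)) powr (-m)) \<partial>phase_law) =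
      ennreal (m powr m) * (\<integral>\<^sup>+p2. ennreal ((m + K + K * \<Delta> * cos (p2 - p1)) powr (-m)) \<partial>phase_law)"
      by (rule nn_integral_cmult) measurable
    thus "(\<integral>\<^sup>+p2. ennreal (m powr m) * ennreal ((m + K + K * \<Delta> * cos (p2 - p1)) powr (-m)) \<partial>phase_law) = ennreal ftr_limit"
      unfolding nn_integral_phase[OF K_Delta_bounds(2,3) m_pos] ftr_limit_def by (simp add: ennreal_mult')
  qed
  also have "\<dots> = ennreal ftr_limit" using phase.emeasure_space_1 by simp
  finally show ?thesis .
qed

text \<open>The disc estimate is uniform in the specular component, so averaging the conditional
  probability \<open>G\<close> over the gamma variable and the phases keeps the same error.\<close>

lemma ftr_snr_small_ball:
  assumes "c \<ge> 0"
  shows "\<bar>\<sigma>\<^sup>2 * prob {\<omega> \<in> space M. ftr_snr V1 V2 \<zeta> \<phi>1 \<phi>2 X Y \<omega> \<le> c} - c / 2 * ftr_limit\<bar> \<le> c * sqrt c / (2 * \<sigma>)"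
proof -
  define e where "e = (\<lambda>z p1 p2. exp (- (((specular_re z p1 p2)\<^sup>2 + (specular_im z p1 p2)\<^sup>2) / (2 * \<sigma>\<^sup>2))))"
  define G where "G = (\<lambda>z p1 p2. \<integral>\<^sup>+x. \<integral>\<^sup>+y. indicator {..c} ((specular_re z p1 p2 + x)\<^sup>2 + (specular_im z p1 p2 + y)\<^sup>2) \<partial>noise_law \<partial>noise_law)"
  define r where "r = c * sqrt c / (2 * \<sigma>)"
  define P where "P = prob {\<omega> \<in> space M. ftr_snr V1 V2 \<zeta> \<phi>1 \<phi>2 X Y \<omega> \<le> c}"
  have [measurable]: "ftr_snr V1 V2 \<zeta> \<phi>1 \<phi>2 X Y \<in> borel_measurable M"
    unfolding ftr_snr_eq by measurable
  have r: "r \<ge> 0" unfolding r_def using assms sigma_pos by simp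
  \<comment> \<open>Two one-sided bounds with the error added replace the absolute value, because
    subtraction truncates in \<open>ennreal\<close>.\<close>
  have G: "ennreal (c / 2) * ennreal (e z p1 p2) \<le> ennreal (\<sigma>\<^sup>2) * G z p1 p2 + ennreal r"
    "ennreal (\<sigma>\<^sup>2) * G z p1 p2 \<le> ennreal (c / 2) * ennreal (e z p1 p2) + ennreal r" for z p1 p2
  proof -
    obtain g where "G z p1 p2 = ennreal g" "g \<ge> 0" "\<bar>\<sigma>\<^sup>2 * g - c / 2 * e z p1 p2\<bar> \<le> r"
      unfolding G_def e_def r_def using gaussian_disc_probability[OF sigma_pos assms] by blast
    thus "ennreal (c / 2) * ennreal (e z p1 p2) \<le> ennreal (\<sigma>\<^sup>2) * G z p1 p2 + ennreal r"
      "ennreal (\<sigma>\<^sup>2) * G z p1 p2 \<le> ennreal (c / 2) * ennreal (e z p1 p2) + ennreal r"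
      using r assms by (auto simp: e_def abs_le_iff simp flip: ennreal_mult' ennreal_plus intro!: ennreal_leI)
  qed
  have [measurable]: "(\<lambda>x. e (f1 x) (f2 x) (f3 x)) \<in> borel_measurable N"
    if "f1 \<in> borel_measurable N" "f2 \<in> borel_measurable N" "f3 \<in> borel_measurable N"
    for f1 f2 f3 and N :: "'c measure"
    using that unfolding e_def by measurable
  interpret noise: prob_space noise_law by (rule prob_space_laws)
  \<comment> \<open>The slack \<open>k\<close> is taken as \<open>r\<close> on the side carrying the
    error and as 0 on the other, here and in \<open>e\<close>.\<close>
  have snr: "(\<integral>\<^sup>+p1. \<integral>\<^sup>+p2. \<integral>\<^sup>+z. ennreal (\<sigma>\<^sup>2) * G z p1 p2 + ennreal k \<partial>zeta_law \<partial>phase_law \<partial>phase_law) =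
      ennreal (\<sigma>\<^sup>2) * ennreal P + ennreal k" for k
  proof -
    have inner: "(\<integral>\<^sup>+x. \<integral>\<^sup>+y. ennreal (\<sigma>\<^sup>2) * indicator {..c} ((a + x)\<^sup>2 + (b + y)\<^sup>2) + ennreal k \<partial>noise_law \<partial>noise_law) =
        ennreal (\<sigma>\<^sup>2) * (\<integral>\<^sup>+x. \<integral>\<^sup>+y. indicator {..c} ((a + x)\<^sup>2 + (b + y)\<^sup>2) \<partial>noise_law \<partial>noise_law) + ennreal k" for a b
    proof -
      have [measurable]: "(\<lambda>x. \<integral>\<^sup>+y. indicator {..c} ((a + x)\<^sup>2 + (b + y)\<^sup>2) \<partial>noise_law) \<in> borel_measurable borel"
        by (rule noise.borel_measurable_nn_integral) measurable
      show ?thesis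
        using noise.emeasure_space_1 by (simp add: nn_integral_add nn_integral_cmult)
    qed
    have "(\<integral>\<^sup>+p1. \<integral>\<^sup>+p2. \<integral>\<^sup>+z. ennreal (\<sigma>\<^sup>2) * G z p1 p2 + ennreal k \<partial>zeta_law \<partial>phase_law \<partial>phase_law) =
        (\<integral>\<^sup>+\<omega>. ennreal (\<sigma>\<^sup>2) * indicator {..c} (ftr_snr V1 V2 \<zeta> \<phi>1 \<phi>2 X Y \<omega>) + ennreal k \<partial>M)"
      using nn_integral_components[of "\<lambda>(z, p1, p2, x, y). ennreal (\<sigma>\<^sup>2) *
        indicator {..c} ((specular_re z p1 p2 + x)\<^sup>2 + (specular_im z p1 p2 + y)\<^sup>2) + ennreal k"]
      unfolding ftr_snr_eq G_def inner[symmetric] by simp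
    also have "\<dots> = ennreal (\<sigma>\<^sup>2) * (\<integral>\<^sup>+\<omega>. indicator {..c} (ftr_snr V1 V2 \<zeta> \<phi>1 \<phi>2 X Y \<omega>) \<partial>M) + ennreal k"
      using emeasure_space_1 by (simp add: nn_integral_add nn_integral_cmult)
    also have "(\<integral>\<^sup>+\<omega>. indicator {..c} (ftr_snr V1 V2 \<zeta> \<phi>1 \<phi>2 X Y \<omega>) \<partial>M) =
        (\<integral>\<^sup>+\<omega>. indicator {\<omega> \<in> space M. ftr_snr V1 V2 \<zeta> \<phi>1 \<phi>2 X Y \<omega> \<le> c} \<omega> \<partial>M)"
      by (intro nn_integral_cong) (auto simp: indicator_def)
    also have "\<dots> = ennreal P"
      unfolding P_def emeasure_eq_measure[symmetric] by (rule nn_integral_indicator) measurable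
    finally show ?thesis .
  qed
  have e: "(\<integral>\<^sup>+p1. \<integral>\<^sup>+p2. \<integral>\<^sup>+z. ennreal (c / 2) * ennreal (e z p1 p2) + ennreal k \<partial>zeta_law \<partial>phase_law \<partial>phase_law) =
      ennreal (c / 2) * ennreal ftr_limit + ennreal k" for k
  proof -
    have "(\<integral>\<^sup>+p1. \<integral>\<^sup>+p2. \<integral>\<^sup>+z. ennreal (c / 2) * ennreal (e z p1 p2) + ennreal k \<partial>zeta_law \<partial>phase_law \<partial>phase_law) =
        (\<integral>\<^sup>+\<omega>. ennreal (c / 2) * ennreal (e (\<zeta> \<omega>) (\<phi>1 \<omega>) (\<phi>2 \<omega>)) + ennreal k \<partial>M)"
      using nn_integral_components[of "\<lambda>(z, p1, p2, x, y). ennreal (c / 2) * ennreal (e z p1 p2) + ennreal k"]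
      using noise.emeasure_space_1 by simp
    also have "\<dots> = ennreal (c / 2) * (\<integral>\<^sup>+\<omega>. ennreal (e (\<zeta> \<omega>) (\<phi>1 \<omega>) (\<phi>2 \<omega>)) \<partial>M) + ennreal k"
      using emeasure_space_1 by (simp add: nn_integral_add nn_integral_cmult)
    finally show ?thesis unfolding e_def nn_integral_specular .
  qed
  have "ennreal (c / 2) * ennreal ftr_limit + ennreal 0 \<le> ennreal (\<sigma>\<^sup>2) * ennreal P + ennreal r"
    unfolding snr[symmetric] e[symmetric] using G(1) by (intro nn_integral_mono) simp
  hence "c / 2 * ftr_limit \<le> \<sigma>\<^sup>2 * P + r"
    using assms r by (simp add: P_def flip: ennreal_mult' ennreal_plus)
  moreover have "ennreal (\<sigma>\<^sup>2) * ennreal P + ennreal 0 \<le> ennreal (c / 2) * ennreal ftr_limit + ennreal r"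
    unfolding snr[symmetric] e[symmetric] using G(2) by (intro nn_integral_mono) simp
  hence "\<sigma>\<^sup>2 * P \<le> c / 2 * ftr_limit + r"
    using assms r ftr_limit_pos by (simp flip: ennreal_mult' ennreal_plus)
  ultimately show ?thesis unfolding P_def r_def by (simp add: abs_le_iff)
qed

end

section \<open>The average bit error rate\<close>

definition Gamma_integrand :: "real \<Rightarrow> real \<Rightarrow> real" where
  "Gamma_integrand s t = indicator {0<..} t * (t powr (s - 1) * exp (- t))"

lemma Gamma_integrand_measurable [measurable]: "Gamma_integrand s \<in> borel_measurable borel"
  unfolding Gamma_integrand_def by measurable

lemma Gamma_integrand_nonneg: "Gamma_integrand s t \<ge> 0"
  by (simp add: Gamma_integrand_def)

lemma nn_integral_Gamma_integrand: "s > 0 \<Longrightarrow> (\<integral>\<^sup>+t. ennreal (Gamma_integrand s t) \<partial>lborel) = ennreal (Gamma s)"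
  using nn_integral_powr_exp[of 1 s] by (simp add: Gamma_integrand_def)

text \<open>Used with \<open>a = 1\<close> for the main term and \<open>a = 3 / 2\<close> for the
  error term of the BER.\<close>

lemma Gamma_integrand_mult_powr: "Gamma_integrand s t * t powr a = Gamma_integrand (s + a) t"
  by (auto simp: Gamma_integrand_def indicator_def powr_add[symmetric] algebra_simps)

lemma upper_Gamma_conv_nn_integral:
  assumes "s > 0" "y \<ge> 0"
  shows "ennreal (upper_Gamma s y) = (\<integral>\<^sup>+t. ennreal (Gamma_integrand s t) * indicator {y<..} t \<partial>lborel)"
    and "upper_Gamma s y \<ge> 0"
proof -
  have eq: "upper_Gamma s y = (LINT t|lborel. Gamma_integrand s t * indicator {y<..} t)"
    unfolding upper_Gamma_def set_lebesgue_integral_def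
    using assms by (intro Bochner_Integration.integral_cong) (auto simp: Gamma_integrand_def indicator_def)
  have "integrable lborel (Gamma_integrand s)"
    using nn_integral_Gamma_integrand[OF assms(1)] Gamma_integrand_nonneg by (intro integrableI_nonneg) auto
  hence int: "integrable lborel (\<lambda>t. Gamma_integrand s t * indicator {y<..} t)"
    by (rule integrable_real_mult_indicator[rotated]) simp
  show "ennreal (upper_Gamma s y) = (\<integral>\<^sup>+t. ennreal (Gamma_integrand s t) * indicator {y<..} t \<partial>lborel)"
    unfolding eq using nn_integral_eq_integral[OF int] Gamma_integrand_nonneg
    by (simp add: ennreal_mult' ennreal_indicator)
  show "upper_Gamma s y \<ge> 0"
    unfolding eq using Gamma_integrand_nonneg by (intro integral_nonneg_AE) auto
qed

text \<open>Write the incomplete gamma function as an integral over \<open>t > \<alpha> * x\<close>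
  and apply Tonelli: the condition becomes \<open>x < t / \<alpha>\<close>, leaving the mass that
  \<open>f\<close> puts below \<open>t / \<alpha>\<close> under a gamma weight.\<close>

lemma avg_BER_conv_nn_integral:
  fixes f :: "real \<Rightarrow> real"
  assumes \<alpha>: "\<alpha> > 0" and \<beta>: "\<beta> > 0" and f [measurable]: "f \<in> borel_measurable borel" and nonneg: "\<And>x. f x \<ge> 0"
  shows "avg_BER \<alpha> \<beta> f = enn2real (\<integral>\<^sup>+t. ennreal (Gamma_integrand \<beta> t / (2 * Gamma \<beta>)) *
     (\<integral>\<^sup>+x. ennreal (f x) * indicator {0<..<t / \<alpha>} x \<partial>lborel) \<partial>lborel)"
proof -
  have G: "Gamma \<beta> > 0" using \<beta> by simp
  have uG: "ennreal (indicator {0<..} x *\<^sub>R (upper_Gamma \<beta> (\<alpha> * x) / (2 * Gamma \<beta>) * f x)) =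
      (\<integral>\<^sup>+t. ennreal (Gamma_integrand \<beta> t / (2 * Gamma \<beta>)) * (ennreal (f x) * (indicator {0<..} x * (if \<alpha> * x < t then 1 else 0))) \<partial>lborel)" for x
  proof (cases "x > 0")
    case True
    have "ennreal (upper_Gamma \<beta> (\<alpha> * x) / (2 * Gamma \<beta>) * f x) = ennreal (f x / (2 * Gamma \<beta>) * upper_Gamma \<beta> (\<alpha> * x))"
      by (simp add: mult.commute)
    also have "\<dots> = ennreal (f x / (2 * Gamma \<beta>)) * ennreal (upper_Gamma \<beta> (\<alpha> * x))"
      using G nonneg by (intro ennreal_mult') simp
    also have "\<dots> = (\<integral>\<^sup>+t. ennreal (f x / (2 * Gamma \<beta>)) * (ennreal (Gamma_integrand \<beta> t) * indicator {\<alpha> * x<..} t) \<partial>lborel)"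
      using True \<alpha> \<beta> by (subst upper_Gamma_conv_nn_integral) (auto simp: nn_integral_cmult)
    also have "\<dots> = (\<integral>\<^sup>+t. ennreal (Gamma_integrand \<beta> t / (2 * Gamma \<beta>)) * (ennreal (f x) * (indicator {0<..} x * (if \<alpha> * x < t then 1 else 0))) \<partial>lborel)"
      using True G nonneg Gamma_integrand_nonneg
      by (intro nn_integral_cong) (auto simp: indicator_def mult.commute simp flip: ennreal_mult')
    finally show ?thesis using True by simp
  qed simp
  \<comment> \<open>Measurability of \<open>upper_Gamma\<close> in \<open>x\<close> is inherited
    from its representation as a parametrised integral.\<close>
  have measb: "(\<lambda>x. indicator {0<..} x *\<^sub>R (upper_Gamma \<beta> (\<alpha> * x) / (2 * Gamma \<beta>) * f x)) \<in> borel_measurable lborel"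
  proof -
    have "(\<lambda>x. enn2real (\<integral>\<^sup>+t. ennreal (Gamma_integrand \<beta> t / (2 * Gamma \<beta>)) * (ennreal (f x) * (indicator {0<..} x * (if \<alpha> * x < t then 1 else 0))) \<partial>lborel)) \<in> borel_measurable borel"
      by measurable
    also have "(\<lambda>x. enn2real (\<integral>\<^sup>+t. ennreal (Gamma_integrand \<beta> t / (2 * Gamma \<beta>)) * (ennreal (f x) * (indicator {0<..} x * (if \<alpha> * x < t then 1 else 0))) \<partial>lborel)) =
       (\<lambda>x. indicator {0<..} x *\<^sub>R (upper_Gamma \<beta> (\<alpha> * x) / (2 * Gamma \<beta>) * f x))"
      unfolding uG[symmetric] using G nonneg upper_Gamma_conv_nn_integral(2)[OF \<beta>] \<alpha>
      by (auto simp: fun_eq_iff indicator_def)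
    finally show ?thesis by simp
  qed
  \<comment> \<open>If the integral diverges, both sides are 0: the left by the default of the
    Bochner integral, the right as \<open>enn2real \<top>\<close>.\<close>
  have "avg_BER \<alpha> \<beta> f = enn2real (\<integral>\<^sup>+x. ennreal (indicator {0<..} x *\<^sub>R (upper_Gamma \<beta> (\<alpha> * x) / (2 * Gamma \<beta>) * f x)) \<partial>lborel)"
    unfolding avg_BER_def set_lebesgue_integral_def using G nonneg upper_Gamma_conv_nn_integral(2)[OF \<beta>] \<alpha>
    by (intro integral_eq_nn_integral[OF measb] AE_I2) (auto simp: indicator_def)
  also have "(\<integral>\<^sup>+x. ennreal (indicator {0<..} x *\<^sub>R (upper_Gamma \<beta> (\<alpha> * x) / (2 * Gamma \<beta>) * f x)) \<partial>lborel) =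
      (\<integral>\<^sup>+x. \<integral>\<^sup>+t. ennreal (Gamma_integrand \<beta> t / (2 * Gamma \<beta>)) * (ennreal (f x) * (indicator {0<..} x * (if \<alpha> * x < t then 1 else 0))) \<partial>lborel \<partial>lborel)"
    unfolding uG ..
  also have "\<dots> = (\<integral>\<^sup>+t. \<integral>\<^sup>+x. ennreal (Gamma_integrand \<beta> t / (2 * Gamma \<beta>)) * (ennreal (f x) * (indicator {0<..} x * (if \<alpha> * x < t then 1 else 0))) \<partial>lborel \<partial>lborel)"
    by (rule lborel_pair.Fubini') measurable
  also have "\<dots> = (\<integral>\<^sup>+t. ennreal (Gamma_integrand \<beta> t / (2 * Gamma \<beta>)) *
     (\<integral>\<^sup>+x. ennreal (f x) * indicator {0<..<t / \<alpha>} x \<partial>lborel) \<partial>lborel)"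
  proof (rule nn_integral_cong)
    fix t
    have "indicator {0<..} x * (if \<alpha> * x < t then 1 else 0) = (indicator {0<..<t / \<alpha>} x :: ennreal)" for x
      using \<alpha> by (auto simp: indicator_def field_simps)
    thus "(\<integral>\<^sup>+x. ennreal (Gamma_integrand \<beta> t / (2 * Gamma \<beta>)) * (ennreal (f x) * (indicator {0<..} x * (if \<alpha> * x < t then 1 else 0))) \<partial>lborel) =
      ennreal (Gamma_integrand \<beta> t / (2 * Gamma \<beta>)) * (\<integral>\<^sup>+x. ennreal (f x) * indicator {0<..<t / \<alpha>} x \<partial>lborel)"
      by (simp add: nn_integral_cmult)
  qed
  finally show ?thesis .
qed

text \<open>A law with a density has no atoms. As \<open>Z\<close> is nonnegative, the two events
  differ only where \<open>Z\<close> is 0 or \<open>c\<close>.\<close>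

lemma (in prob_space) prob_le_conv_density:
  fixes Z :: "'a \<Rightarrow> real"
  assumes Z: "distributed M lborel Z (\<lambda>x. ennreal (f x))" and nonneg: "\<And>\<omega>. Z \<omega> \<ge> 0"
  shows "(\<integral>\<^sup>+x. ennreal (f x) * indicator {0<..<c} x \<partial>lborel) = ennreal (prob {\<omega> \<in> space M. Z \<omega> \<le> c})"
proof -
  have [measurable]: "Z \<in> borel_measurable M" "(\<lambda>x. ennreal (f x)) \<in> borel_measurable borel"
    using Z by (auto simp: distributed_def)
  have point: "emeasure M {\<omega> \<in> space M. Z \<omega> = a} = 0" for a
  proof -
    have "emeasure M (Z -` {a} \<inter> space M) = (\<integral>\<^sup>+x. ennreal (f x) * indicator {a} x \<partial>lborel)"
      by (rule distributed_emeasure[OF Z]) simp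
    also have "\<dots> = (\<integral>\<^sup>+(x :: real). 0 \<partial>lborel)"
      using AE_lborel_singleton[of a] by (intro nn_integral_cong_AE) (auto elim!: eventually_mono)
    finally show ?thesis by (simp add: vimage_def Int_def conj_commute)
  qed
  have "AE \<omega> in M. Z \<omega> \<noteq> a" for a
    using point[of a] by (subst AE_iff_measurable[OF _ refl]) auto
  from this[of 0] this[of c] have "emeasure M (Z -` {0<..<c} \<inter> space M) = emeasure M {\<omega> \<in> space M. Z \<omega> \<le> c}"
  proof (intro emeasure_eq_AE)
    assume "AE \<omega> in M. Z \<omega> \<noteq> 0" "AE \<omega> in M. Z \<omega> \<noteq> c"
    thus "AE \<omega> in M. (\<omega> \<in> Z -` {0<..<c} \<inter> space M) = (\<omega> \<in> {\<omega> \<in> space M. Z \<omega> \<le> c})"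
      by eventually_elim (use nonneg in \<open>auto simp: order.order_iff_strict\<close>)
  qed measurable
  thus ?thesis
    using distributed_emeasure[OF Z, of "{0<..<c}"] by (simp add: emeasure_eq_measure)
qed

text \<open>The small-ball estimate at \<open>c = t / \<alpha>\<close> is integrated against the
  gamma weight. The main term is linear in \<open>t\<close> and raises the gamma parameter by 1, the
  error is of order t^(3/2) and raises it by 3/2. Each denominator 4 combines the 2 of the BER with
  the 2 of the small-ball estimate.\<close>

lemma (in ftr_channel) avg_BER_high_snr:
  fixes f :: "real \<Rightarrow> real"
  assumes \<alpha>: "\<alpha> > 0" and \<beta>: "\<beta> > 0" and nonneg: "\<And>x. f x \<ge> 0"
    and density: "distributed M lborel (ftr_snr V1 V2 \<zeta> \<phi>1 \<phi>2 X Y) (\<lambda>x. ennreal (f x))"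
  shows "\<bar>\<sigma>\<^sup>2 * avg_BER \<alpha> \<beta> f - Gamma (\<beta> + 1) / (4 * \<alpha> * Gamma \<beta>) * ftr_limit\<bar> \<le>
    Gamma (\<beta> + 3 / 2) / (4 * Gamma \<beta> * \<alpha> powr (3 / 2)) / \<sigma>"
proof -
  define p where "p = (\<lambda>t. prob {\<omega> \<in> space M. ftr_snr V1 V2 \<zeta> \<phi>1 \<phi>2 X Y \<omega> \<le> t / \<alpha>})"
  define w where "w = (\<lambda>t. Gamma_integrand \<beta> t / (2 * Gamma \<beta>))"
  define J where "J = (\<integral>\<^sup>+t. ennreal (w t * p t) \<partial>lborel)"
  define A where "A = Gamma (\<beta> + 1) / (4 * \<alpha> * Gamma \<beta>) * ftr_limit"
  define B where "B = Gamma (\<beta> + 3 / 2) / (4 * Gamma \<beta> * \<alpha> powr (3 / 2)) / \<sigma>"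
  have G: "Gamma \<beta> > 0" "Gamma (\<beta> + 1) > 0" "Gamma (\<beta> + 3 / 2) > 0" using \<beta> by simp_all
  have [measurable]: "ftr_snr V1 V2 \<zeta> \<phi>1 \<phi>2 X Y \<in> borel_measurable M"
    using density by (simp add: distributed_def)
  have "(\<lambda>x. ennreal (f x)) \<in> borel_measurable borel" using density by (simp add: distributed_def)
  hence "(\<lambda>x. enn2real (ennreal (f x))) \<in> borel_measurable borel" by measurable
  hence f_meas: "f \<in> borel_measurable borel" using nonneg by simp
  \<comment> \<open>A distribution function is monotone, hence Borel measurable.\<close>
  have "mono p"
    unfolding p_def using \<alpha>
    by (intro monoI finite_measure_mono) (auto simp: divide_right_mono intro: order_trans)
  hence [measurable]: "p \<in> borel_measurable borel" by (rule borel_measurable_mono)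
  have [measurable]: "w \<in> borel_measurable borel" unfolding w_def by measurable
  have w: "w t \<ge> 0" for t unfolding w_def using G Gamma_integrand_nonneg by simp
  have p: "p t \<ge> 0" for t unfolding p_def by simp
  have BER: "avg_BER \<alpha> \<beta> f = enn2real J"
  proof -
    have "avg_BER \<alpha> \<beta> f = enn2real (\<integral>\<^sup>+t. ennreal (w t) * ennreal (p t) \<partial>lborel)"
      unfolding avg_BER_conv_nn_integral[OF \<alpha> \<beta> f_meas nonneg] w_def p_def
      by (subst prob_le_conv_density[OF density]) (simp_all add: ftr_snr_def)
    thus ?thesis unfolding J_def ennreal_mult[OF w p] .
  qed
  have main: "(\<integral>\<^sup>+t. ennreal (w t * (t / \<alpha> / 2 * ftr_limit)) \<partial>lborel) = ennreal A"
  proof -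
    have "(\<integral>\<^sup>+t. ennreal (w t * (t / \<alpha> / 2 * ftr_limit)) \<partial>lborel) =
        (\<integral>\<^sup>+t. ennreal (ftr_limit / (4 * \<alpha> * Gamma \<beta>)) * ennreal (Gamma_integrand (\<beta> + 1) t) \<partial>lborel)"
    proof (rule nn_integral_cong)
      fix t
      have "w t * (t / \<alpha> / 2 * ftr_limit) = ftr_limit / (4 * \<alpha> * Gamma \<beta>) * Gamma_integrand (\<beta> + 1) t"
        unfolding Gamma_integrand_mult_powr[symmetric] w_def by (simp add: Gamma_integrand_def indicator_def mult_ac)
      thus "ennreal (w t * (t / \<alpha> / 2 * ftr_limit)) = ennreal (ftr_limit / (4 * \<alpha> * Gamma \<beta>)) * ennreal (Gamma_integrand (\<beta> + 1) t)"
        using G \<alpha> ftr_limit_pos by (simp only:) (intro ennreal_mult', simp)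
    qed
    also have "\<dots> = ennreal A"
      using \<beta> \<alpha> G ftr_limit_pos
      by (subst nn_integral_cmult) (simp_all add: nn_integral_Gamma_integrand A_def mult.commute flip: ennreal_mult')
    finally show ?thesis .
  qed
  have err: "(\<integral>\<^sup>+t. ennreal (w t * (t / \<alpha> * sqrt (t / \<alpha>) / (2 * \<sigma>))) \<partial>lborel) = ennreal B"
  proof -
    have "(\<integral>\<^sup>+t. ennreal (w t * (t / \<alpha> * sqrt (t / \<alpha>) / (2 * \<sigma>))) \<partial>lborel) =
        (\<integral>\<^sup>+t. ennreal (1 / (4 * Gamma \<beta> * \<alpha> powr (3 / 2)) / \<sigma>) * ennreal (Gamma_integrand (\<beta> + 3 / 2) t) \<partial>lborel)"
    proof (rule nn_integral_cong)
      fix t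
      have "t / \<alpha> * sqrt (t / \<alpha>) = t powr (3 / 2) / \<alpha> powr (3 / 2)" if "t > 0"
      proof -
        have "t / \<alpha> * sqrt (t / \<alpha>) = (t / \<alpha>) powr 1 * (t / \<alpha>) powr (1 / 2)"
          using that \<alpha> by (simp add: powr_half_sqrt)
        also have "\<dots> = (t / \<alpha>) powr (3 / 2)" by (subst powr_add[symmetric]) simp
        also have "\<dots> = t powr (3 / 2) / \<alpha> powr (3 / 2)" using that \<alpha> by (simp add: powr_divide)
        finally show ?thesis .
      qed
      hence "w t * (t / \<alpha> * sqrt (t / \<alpha>) / (2 * \<sigma>)) = w t * (t powr (3 / 2) / \<alpha> powr (3 / 2) / (2 * \<sigma>))"
        by (cases "t > 0") (simp_all add: w_def Gamma_integrand_def)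
      also have "\<dots> = 1 / (4 * Gamma \<beta> * \<alpha> powr (3 / 2)) / \<sigma> * Gamma_integrand (\<beta> + 3 / 2) t"
        unfolding Gamma_integrand_mult_powr[symmetric] w_def by simp
      finally have "w t * (t / \<alpha> * sqrt (t / \<alpha>) / (2 * \<sigma>)) =
          1 / (4 * Gamma \<beta> * \<alpha> powr (3 / 2)) / \<sigma> * Gamma_integrand (\<beta> + 3 / 2) t" .
      thus "ennreal (w t * (t / \<alpha> * sqrt (t / \<alpha>) / (2 * \<sigma>))) =
          ennreal (1 / (4 * Gamma \<beta> * \<alpha> powr (3 / 2)) / \<sigma>) * ennreal (Gamma_integrand (\<beta> + 3 / 2) t)"
        using G \<alpha> sigma_pos by (simp only:) (intro ennreal_mult', simp)
    qed
    also have "\<dots> = ennreal B"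
      using \<beta> \<alpha> G sigma_pos
      by (subst nn_integral_cmult) (simp_all add: nn_integral_Gamma_integrand B_def flip: ennreal_mult')
    finally show ?thesis .
  qed
  have J: "(\<integral>\<^sup>+t. ennreal (w t * (\<sigma>\<^sup>2 * p t)) \<partial>lborel) = ennreal (\<sigma>\<^sup>2) * J"
  proof -
    have "(\<integral>\<^sup>+t. ennreal (w t * (\<sigma>\<^sup>2 * p t)) \<partial>lborel) = (\<integral>\<^sup>+t. ennreal (\<sigma>\<^sup>2) * ennreal (w t * p t) \<partial>lborel)"
      by (intro nn_integral_cong) (subst ennreal_mult'[symmetric], simp_all add: mult.left_commute)
    thus ?thesis unfolding J_def by (simp add: nn_integral_cmult)
  qed
  \<comment> \<open>For \<open>t \<le> 0\<close> the weight vanishes; for \<open>t > 0\<close> the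
    threshold \<open>t / \<alpha>\<close> is admissible in the small-ball estimate.\<close>
  have small: "w t = 0 \<or> \<bar>\<sigma>\<^sup>2 * p t - t / \<alpha> / 2 * ftr_limit\<bar> \<le> t / \<alpha> * sqrt (t / \<alpha>) / (2 * \<sigma>)" for t
    using ftr_snr_small_ball[of "t / \<alpha>"] \<alpha> by (cases "t > 0") (auto simp: w_def p_def Gamma_integrand_def)
  have upper: "ennreal (\<sigma>\<^sup>2) * J \<le> ennreal A + ennreal B"
  proof -
    have "ennreal (\<sigma>\<^sup>2) * J \<le> (\<integral>\<^sup>+t. ennreal (w t * (t / \<alpha> / 2 * ftr_limit)) + ennreal (w t * (t / \<alpha> * sqrt (t / \<alpha>) / (2 * \<sigma>))) \<partial>lborel)"
      unfolding J[symmetric]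
    proof (rule nn_integral_mono)
      fix t
      show "ennreal (w t * (\<sigma>\<^sup>2 * p t)) \<le> ennreal (w t * (t / \<alpha> / 2 * ftr_limit)) + ennreal (w t * (t / \<alpha> * sqrt (t / \<alpha>) / (2 * \<sigma>)))"
      proof (cases "t > 0")
        case True
        have "w t * (\<sigma>\<^sup>2 * p t) \<le> w t * (t / \<alpha> / 2 * ftr_limit + t / \<alpha> * sqrt (t / \<alpha>) / (2 * \<sigma>))"
        proof (cases "w t = 0")
          case False
          thus ?thesis using small[of t] w[of t] by (intro mult_left_mono) (auto simp: abs_le_iff)
        qed simp
        thus ?thesis using True w[of t] \<alpha> sigma_pos ftr_limit_pos
          by (simp add: distrib_left ennreal_leI flip: ennreal_plus)
      qed (simp add: w_def Gamma_integrand_def)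
    qed
    also have "\<dots> = ennreal A + ennreal B"
      unfolding main[symmetric] err[symmetric] by (rule nn_integral_add) measurable
    finally show ?thesis .
  qed
  have lower: "ennreal A \<le> ennreal (\<sigma>\<^sup>2) * J + ennreal B"
  proof -
    have "ennreal A \<le> (\<integral>\<^sup>+t. ennreal (w t * (\<sigma>\<^sup>2 * p t)) + ennreal (w t * (t / \<alpha> * sqrt (t / \<alpha>) / (2 * \<sigma>))) \<partial>lborel)"
      unfolding main[symmetric]
    proof (rule nn_integral_mono)
      fix t
      show "ennreal (w t * (t / \<alpha> / 2 * ftr_limit)) \<le> ennreal (w t * (\<sigma>\<^sup>2 * p t)) + ennreal (w t * (t / \<alpha> * sqrt (t / \<alpha>) / (2 * \<sigma>)))"
      proof (cases "t > 0")
        case True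
        have "w t * (t / \<alpha> / 2 * ftr_limit) \<le> w t * (\<sigma>\<^sup>2 * p t + t / \<alpha> * sqrt (t / \<alpha>) / (2 * \<sigma>))"
        proof (cases "w t = 0")
          case False
          thus ?thesis using small[of t] w[of t] by (intro mult_left_mono) (auto simp: abs_le_iff)
        qed simp
        thus ?thesis using True w[of t] p[of t] \<alpha> sigma_pos
          by (simp add: distrib_left ennreal_leI flip: ennreal_plus)
      qed (simp add: w_def Gamma_integrand_def)
    qed
    also have "\<dots> = ennreal (\<sigma>\<^sup>2) * J + ennreal B"
      unfolding J[symmetric] err[symmetric] by (rule nn_integral_add) measurable
    finally show ?thesis .
  qed
  have AB: "A \<ge> 0" "B \<ge> 0"
    unfolding A_def B_def using G \<alpha> sigma_pos ftr_limit_pos by simp_all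
  \<comment> \<open>The upper bound forces finiteness because \<open>\<sigma>\<^sup>2\<close> is
    nonzero; afterwards both bounds can be read as real inequalities.\<close>
  have "J < \<top>"
    using upper sigma_pos by (auto simp: less_top[symmetric] ennreal_mult_eq_top_iff top_unique)
  then obtain j where j: "J = ennreal j" "j \<ge> 0" by (cases J) auto
  have "\<sigma>\<^sup>2 * j \<le> A + B" "A \<le> \<sigma>\<^sup>2 * j + B"
    using upper lower AB j by (simp_all flip: ennreal_mult' ennreal_plus)
  thus ?thesis
    unfolding A_def[symmetric] B_def[symmetric] BER using j by (simp add: abs_le_iff)
qed

theorem mainTheorem4:
  fixes m \<alpha> \<beta> K \<Delta> :: real
    and M :: "real \<Rightarrow> 'a measure"
    and V1 V2 :: "real \<Rightarrow> real"
    and \<zeta> \<phi>1 \<phi>2 X Y :: "real \<Rightarrow> 'a \<Rightarrow> real"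
    and f :: "real \<Rightarrow> real \<Rightarrow> real"
  assumes "m > 0" and "\<alpha> > 0" and "\<beta> > 0" and "K > 0" and "\<Delta> \<in> {0..1}"
    and channel: "\<And>\<sigma>. \<sigma> > 0 \<Longrightarrow>
          ftr_channel (M \<sigma>) m \<sigma> (V1 \<sigma>) (V2 \<sigma>) (\<zeta> \<sigma>) (\<phi>1 \<sigma>) (\<phi>2 \<sigma>) (X \<sigma>) (Y \<sigma>)"
    and K_fixed: "\<And>\<sigma>. \<sigma> > 0 \<Longrightarrow> ftr_K \<sigma> (V1 \<sigma>) (V2 \<sigma>) = K"
    and Delta_fixed: "\<And>\<sigma>. \<sigma> > 0 \<Longrightarrow> ftr_Delta (V1 \<sigma>) (V2 \<sigma>) = \<Delta>"
    and density_nonneg: "\<And>\<sigma> x. \<sigma> > 0 \<Longrightarrow> f \<sigma> x \<ge> 0"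
    and density: "\<And>\<sigma>. \<sigma> > 0 \<Longrightarrow>
          distributed (M \<sigma>) lborel
            (ftr_snr (V1 \<sigma>) (V2 \<sigma>) (\<zeta> \<sigma>) (\<phi>1 \<sigma>) (\<phi>2 \<sigma>) (X \<sigma>) (Y \<sigma>)) (\<lambda>x. ennreal (f \<sigma> x))"
  shows "((\<lambda>\<sigma>. avg_BER \<alpha> \<beta> (f \<sigma>) / BER_asymptote m \<alpha> \<beta> K \<Delta> \<sigma>) \<longlongrightarrow> 1) at_top"
proof -
  define L where "L = m powr m * (((m + K)\<^sup>2 - (K * \<Delta>)\<^sup>2) powr (-m/2) *
     legendre_P (m - 1) ((m + K) / sqrt ((m + K)\<^sup>2 - (K * \<Delta>)\<^sup>2)))"
  define A where "A = Gamma (\<beta> + 1) / (4 * \<alpha> * Gamma \<beta>) * L"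
  define B where "B = Gamma (\<beta> + 3 / 2) / (4 * Gamma \<beta> * \<alpha> powr (3 / 2))"
  \<comment> \<open>With \<open>K\<close> and \<open>\<Delta>\<close> fixed, the channels for all
    \<sigma> share one constant, even though each has its own probability measure.\<close>
  have limit: "ftr_channel.ftr_limit m \<sigma> (V1 \<sigma>) (V2 \<sigma>) = L" if "\<sigma> > 0" for \<sigma>
    using ftr_channel.ftr_limit_def[OF channel[OF that]] K_fixed[OF that] Delta_fixed[OF that]
    by (simp add: L_def)
  \<comment> \<open>The channel at \<sigma> = 1 serves as an instance of the locale. Positivity
    allows dividing by the limit.\<close>
  have "L > 0"
    using ftr_channel.ftr_limit_pos[OF channel, of 1] limit[of 1] by simp
  hence "A > 0" using \<open>\<alpha> > 0\<close> \<open>\<beta> > 0\<close> by (simp add: A_def)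
  \<comment> \<open>The claimed asymptote is exactly \<open>A / \<sigma>\<^sup>2\<close>, so the
    claim reduces to convergence of \<sigma>^2 times the BER to \<open>A\<close>.\<close>
  have asymptote: "BER_asymptote m \<alpha> \<beta> K \<Delta> \<sigma> = A / \<sigma>\<^sup>2" for \<sigma>
    by (simp add: BER_asymptote_def A_def L_def mult_ac)
  \<comment> \<open>The quantitative bound squeezes the difference by \<open>B / \<sigma>\<close>,
    with \<open>B\<close> free of \<sigma>.\<close>
  have "((\<lambda>\<sigma>. \<sigma>\<^sup>2 * avg_BER \<alpha> \<beta> (f \<sigma>) - A) \<longlongrightarrow> 0) at_top"
  proof (rule tendsto_rabs_zero_cancel, rule tendsto_sandwich[OF _ _ tendsto_const])
    show "((\<lambda>\<sigma>. B / \<sigma>) \<longlongrightarrow> 0) at_top"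
      by (intro tendsto_divide_0[OF tendsto_const] filterlim_at_top_imp_at_infinity filterlim_ident)
    show "\<forall>\<^sub>F \<sigma> in at_top. \<bar>\<sigma>\<^sup>2 * avg_BER \<alpha> \<beta> (f \<sigma>) - A\<bar> \<le> B / \<sigma>"
      using eventually_gt_at_top[of 0]
    proof eventually_elim
      case (elim \<sigma>)
      show ?case
        using ftr_channel.avg_BER_high_snr[OF channel[OF elim] \<open>\<alpha> > 0\<close> \<open>\<beta> > 0\<close> density_nonneg[OF elim] density[OF elim]]
        by (simp only: limit[OF elim] A_def B_def)
    qed
  qed simp
  hence "((\<lambda>\<sigma>. \<sigma>\<^sup>2 * avg_BER \<alpha> \<beta> (f \<sigma>)) \<longlongrightarrow> A) at_top"
    by (rule LIM_zero_cancel)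
  hence "((\<lambda>\<sigma>. \<sigma>\<^sup>2 * avg_BER \<alpha> \<beta> (f \<sigma>) / A) \<longlongrightarrow> A / A) at_top"
    using \<open>A > 0\<close> by (intro tendsto_divide tendsto_const) auto
  moreover have "avg_BER \<alpha> \<beta> (f \<sigma>) / BER_asymptote m \<alpha> \<beta> K \<Delta> \<sigma> = \<sigma>\<^sup>2 * avg_BER \<alpha> \<beta> (f \<sigma>) / A" for \<sigma>
    unfolding asymptote by simp
  ultimately show ?thesis using \<open>A > 0\<close> by simp
qed

end
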